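(* Let $K$ be an infinite compact $F$-space, let $E=C(K)$ be the Banach space of continuous real-valued functions on $K$, and set $H:=(E',\mu(E',E))$, where $\mu(E',E)$ is the Mackey topology on the dual $E'$. Then: (i) $H$ is a complete space and has the Schur property; (ii) $H$ does not weakly respect compactness.
   Context: A Tychonoff space $X$ is an $F$-space if every cozero-set $A$ in $X$ is $C^*$-embedded, i.e. every bounded continuous real-valued function on $A$ extends to a continuous function on $X$. $\mu(E',E)$ is the topology of uniform convergence on absolutely convex $\sigma(E,E')$-compact subsets of $E$. For a locally convex space $H$, $H_w$ is $H$ with its weak topology $\sigma(H,H')$ (here $\sigma(E',E)$). $H$ has the Schur property if $H$ and $H_w$ have the same convergent sequences. $H$ weakly respects compactness if $H$ and $H_w$ have the same compact subsets. *)

theory Defs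
  imports "HOL-Analysis.Analysis"
begin

section \<open>F-spaces\<close>

definition cozero_set_of :: "'a topology \<Rightarrow> 'a set \<Rightarrow> bool" where
  "cozero_set_of X A \<longleftrightarrow>
     (\<exists>f. continuous_map X euclideanreal f \<and> A = {x \<in> topspace X. f x \<noteq> 0})"

definition Cstar_embedded :: "'a topology \<Rightarrow> 'a set \<Rightarrow> bool" where
  "Cstar_embedded X A \<longleftrightarrow>
     (\<forall>g. continuous_map (subtopology X A) euclideanreal g \<and> bounded (g ` A) \<longrightarrow>
          (\<exists>h. continuous_map X euclideanreal h \<and> (\<forall>x\<in>A. h x = g x)))"

definition F_space :: "'a topology \<Rightarrow> bool" where
  "F_space X \<longleftrightarrow>
     completely_regular_space X \<and> Hausdorff_space X \<and>
     (\<forall>A. cozero_set_of X A \<longrightarrow> Cstar_embedded X A)"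


section \<open>Topologies on real vector spaces\<close>

text \<open>
  A locally convex space is given by a topology \<open>T\<close> with \<open>topspace T = UNIV\<close> on a type of
  class \<^class>\<open>real_vector\<close>. The topology \<open>weak_of T\<close> is the weak topology of that space, that
  is, the coarsest one for which all \<open>T\<close>-continuous linear functionals are continuous.
\<close>

definition weak_of :: "'v::real_vector topology \<Rightarrow> 'v topology" where
  "weak_of T = topology_generated_by
     {f -` U | f U. linear f \<and> continuous_map T euclideanreal f \<and> open (U :: real set)}"

text \<open>
  Completeness for the translation-invariant uniformity of the vector space, expressed with
  filters: \<open>F\<close> is Cauchy if for each neighbourhood \<open>U\<close> of 0 it contains a set \<open>A\<close> with
  \<open>A - A \<subseteq> U\<close>.
\<close>

definition cauchy_filter_in :: "'v::real_vector topology \<Rightarrow> 'v filter \<Rightarrow> bool" where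
  "cauchy_filter_in T F \<longleftrightarrow>
     F \<noteq> bot \<and>
     (\<forall>U. openin T U \<and> 0 \<in> U \<longrightarrow>
          (\<exists>A. (\<forall>\<^sub>F x in F. x \<in> A) \<and> (\<forall>x\<in>A. \<forall>y\<in>A. x - y \<in> U)))"

definition complete_lcs :: "'v::real_vector topology \<Rightarrow> bool" where
  "complete_lcs T \<longleftrightarrow> (\<forall>F. cauchy_filter_in T F \<longrightarrow> (\<exists>l. limitin T (\<lambda>x. x) l F))"

definition Schur_property :: "'v::real_vector topology \<Rightarrow> bool" where
  "Schur_property T \<longleftrightarrow>
     (\<forall>(s :: nat \<Rightarrow> 'v) l. limitin T s l sequentially \<longleftrightarrow> limitin (weak_of T) s l sequentially)"

definition weakly_respects_compactness :: "'v::real_vector topology \<Rightarrow> bool" where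
  "weakly_respects_compactness T \<longleftrightarrow> (\<forall>C. compactin T C \<longleftrightarrow> compactin (weak_of T) C)"


section \<open>The Mackey topology of the dual of a normed space\<close>

definition absolutely_convex :: "'v::real_vector set \<Rightarrow> bool" where
  "absolutely_convex W \<longleftrightarrow>
     (\<forall>x\<in>W. \<forall>y\<in>W. \<forall>a b. \<bar>a\<bar> + \<bar>b\<bar> \<le> 1 \<longrightarrow> a *\<^sub>R x + b *\<^sub>R y \<in> W)"

text \<open>
  The neighbourhood filter at \<open>\<phi>\<close> of the topology of uniform convergence on the members of
  \<open>\<W>\<close>: it is generated by the sets \<open>{\<psi>. \<forall>x\<in>W. dist (\<psi> x) (\<phi> x) < e}\<close> with
  \<open>W \<in> \<W>\<close> and \<open>e > 0\<close>.
\<close>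

definition unif_conv_nhds ::
    "'e::real_normed_vector set set \<Rightarrow> ('e \<Rightarrow>\<^sub>L real) \<Rightarrow> ('e \<Rightarrow>\<^sub>L real) filter" where
  "unif_conv_nhds \<W> \<phi> =
     filtercomap blinfun_apply (INF W\<in>\<W>. uniformly_on W (blinfun_apply \<phi>))"

definition unif_conv_topology ::
    "'e::real_normed_vector set set \<Rightarrow> ('e \<Rightarrow>\<^sub>L real) topology" where
  "unif_conv_topology \<W> =
     topology (\<lambda>U. \<forall>\<phi>\<in>U. \<forall>\<^sub>F \<psi> in unif_conv_nhds \<W> \<phi>. \<psi> \<in> U)"

lemma openin_unif_conv_topology:
  "openin (unif_conv_topology \<W>) U \<longleftrightarrow>
     (\<forall>\<phi>\<in>U. \<forall>\<^sub>F \<psi> in unif_conv_nhds \<W> \<phi>. \<psi> \<in> U)"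
proof -
  have "istopology (\<lambda>U. \<forall>\<phi>\<in>U. \<forall>\<^sub>F \<psi> in unif_conv_nhds \<W> \<phi>. \<psi> \<in> U)"
    unfolding istopology_def
  proof (intro conjI allI impI ballI)
    fix S T \<phi>
    assume "\<forall>\<phi>\<in>S. \<forall>\<^sub>F \<psi> in unif_conv_nhds \<W> \<phi>. \<psi> \<in> S"
      and "\<forall>\<phi>\<in>T. \<forall>\<^sub>F \<psi> in unif_conv_nhds \<W> \<phi>. \<psi> \<in> T" and "\<phi> \<in> S \<inter> T"
    then show "\<forall>\<^sub>F \<psi> in unif_conv_nhds \<W> \<phi>. \<psi> \<in> S \<inter> T"
      by (simp add: eventually_conj)
  next
    fix \<K> \<phi>
    assume "\<forall>K\<in>\<K>. \<forall>\<phi>\<in>K. \<forall>\<^sub>F \<psi> in unif_conv_nhds \<W> \<phi>. \<psi> \<in> K" and "\<phi> \<in> \<Union>\<K>"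
    then obtain K where "K \<in> \<K>" and "\<forall>\<^sub>F \<psi> in unif_conv_nhds \<W> \<phi>. \<psi> \<in> K"
      by blast
    then show "\<forall>\<^sub>F \<psi> in unif_conv_nhds \<W> \<phi>. \<psi> \<in> \<Union>\<K>"
      by (auto elim: eventually_mono)
  qed
  then show ?thesis
    unfolding unif_conv_topology_def by (simp add: topology_inverse')
qed

lemma topspace_unif_conv_topology [simp]: "topspace (unif_conv_topology \<W>) = UNIV"
proof -
  have "openin (unif_conv_topology \<W>) UNIV"
    by (simp add: openin_unif_conv_topology)
  then show ?thesis
    using openin_subset by blast
qed

text \<open>
  The topology \<open>\<mu>(E',E)\<close>; here \<open>weak_of euclidean\<close> is \<open>\<sigma>(E,E')\<close>, since
  \<^term>\<open>euclidean\<close> at the type of \<open>E\<close> is the norm topology.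
\<close>

definition mackey_dual :: "('e::real_normed_vector \<Rightarrow>\<^sub>L real) topology" where
  "mackey_dual =
     unif_conv_topology
       {W. absolutely_convex W \<and> compactin (weak_of (euclidean :: 'e topology)) W}"

end

theory Submission
  imports Defs
begin

text \<open>
  Completeness: a Mackey--Cauchy filter converges pointwise, and its limit is bounded on the weakly
  compact absolutely convex hull of every null sequence, hence bounded.

  Schur property: by Eberlein's theorem, it suffices that
  \<open>\<phi>\<^sub>n (h\<^sub>n) \<rightarrow> 0\<close> whenever \<open>(\<phi>\<^sub>n)\<close> is weak* null and \<open>(h\<^sub>n)\<close> is a bounded sequence in \<open>C(K)\<close>
  tending to 0 pointwise. This combines the Grothendieck and the Dunford--Pettis property of
  \<open>C(K)\<close>, and can be done without representing measures. Let \<open>p(f)\<close> be the supremum of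
  \<open>\<bar>\<phi>\<^sub>n v\<bar>\<close> over all \<open>n\<close> and all \<open>\<bar>v\<bar> \<le> f\<close>. A gliding hump, in which the \<open>F\<close>-space property
  supplies the sum of infinitely many disjoint functions, shows that \<open>p\<close> tends to 0 along disjoint
  bounded sequences; hence \<open>p\<close> is Cauchy along monotone bounded sequences, and a
  Dini argument turns pointwise convergence of \<open>(h\<^sub>n)\<close> into \<open>p(\<bar>h\<^sub>n\<bar>) \<rightarrow> 0\<close>.

  Compactness: by the Mackey--Arens theorem the point evaluations form a weakly compact set. A disjoint
  sequence of bumps \<open>u\<^sub>n\<close> with \<open>u\<^sub>n(x\<^sub>n) = 1\<close> is weakly null, so its hull is weakly compact, and uniform convergence
  on this hull separates the evaluations at the points \<open>x\<^sub>n\<close>.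
\<close>

section \<open>Weak* null sequences of functionals on compact \<open>F\<close>-spaces\<close>

text \<open>The cozero sets of the \<open>w i\<close> have a cozero union: \<open>W\<close>, the sum
  of their truncations with weights \<open>(1/2) ^ i\<close>, is continuous by the M-test. The
  \<open>s i\<close> agree on overlaps and paste to a bounded continuous function on this union,
  which extends by C*-embedding.\<close>

lemma F_space_glue:
  fixes w s :: "nat \<Rightarrow> 'k::topological_space \<Rightarrow> real"
  assumes F: "F_space (euclidean :: 'k topology)"
    and w: "\<And>i. continuous_on UNIV (w i)" and s: "\<And>i. continuous_on UNIV (s i)"
    and bd: "\<And>i x. \<bar>s i x\<bar> \<le> c"
    and agree: "\<And>i j x. w i x \<noteq> 0 \<Longrightarrow> w j x \<noteq> 0 \<Longrightarrow> s i x = s j x"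
  obtains h where "continuous_on UNIV h" "\<And>i x. w i x \<noteq> 0 \<Longrightarrow> h x = s i x" "\<And>x. \<bar>h x\<bar> \<le> c"
proof -
  define t where "t i x = (1/2::real) ^ i * min 1 \<bar>w i x\<bar>" for i x
  have t0: "0 \<le> t i x" for i x by (simp add: t_def)
  have t1: "t i x \<le> (1/2) ^ i" for i x by (simp add: t_def)
  have summ: "summable (\<lambda>i. t i x)" for x
    by (rule summable_comparison_test'[of "\<lambda>i. (1/2::real)^i" 0]) (use t0 t1 in \<open>auto simp: summable_geometric\<close>)
  define W where "W x = (\<Sum>i. t i x)" for x
  have ul: "uniform_limit UNIV (\<lambda>n x. \<Sum>i<n. t i x) W sequentially"
    unfolding W_def
    by (rule Weierstrass_m_test[of _ _ "\<lambda>i. (1/2::real)^i"]) (use t0 t1 in \<open>auto simp: summable_geometric\<close>)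
  have contW: "continuous_on UNIV W"
    by (rule uniform_limit_theorem[OF _ ul]) (auto simp: t_def intro!: always_eventually continuous_intros w)
  have Wiff: "W x \<noteq> 0 \<longleftrightarrow> (\<exists>i. w i x \<noteq> 0)" for x
    unfolding W_def suminf_eq_zero_iff[OF summ t0] by (auto simp: t_def min_def)
  define A where "A = {x. W x \<noteq> 0}"
  have A: "A = (\<Union>i. {x. w i x \<noteq> 0})" by (auto simp: A_def Wiff)
  have op: "open {x. w i x \<noteq> 0}" for i
    by (rule open_Collect_neq) (auto intro: w)
  define G where "G x = s (LEAST i. w i x \<noteq> 0) x" for x
  have G: "G x = s i x" if "w i x \<noteq> 0" for i x
    unfolding G_def by (rule agree[OF LeastI that]) (rule that)
  have contG: "continuous_on A G"
    unfolding A
  proof (rule continuous_on_open_UN)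
    fix i :: nat
    have "continuous_on {x. w i x \<noteq> 0} (s i)" using s continuous_on_subset by blast
    then show "continuous_on {x. w i x \<noteq> 0} G"
      by (rule continuous_on_eq) (simp add: G)
  qed (use op in auto)
  have "cozero_set_of (euclidean :: 'k topology) A"
    unfolding cozero_set_of_def by (rule exI[of _ W]) (use contW in \<open>auto simp: A_def\<close>)
  then have "Cstar_embedded (euclidean :: 'k topology) A" using F by (simp add: F_space_def)
  moreover have "bounded (G ` A)"
    unfolding bounded_iff by (rule exI[of _ c]) (auto simp: G_def bd)
  ultimately obtain h0 where h0: "continuous_on UNIV h0" "\<And>x. x \<in> A \<Longrightarrow> h0 x = G x"
    using contG unfolding Cstar_embedded_def by (metis continuous_map_iff_continuous continuous_map_iff_continuous2)
  \<comment> \<open>The extension may exceed \<open>c\<close> off \<open>A\<close>; clipping it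
    leaves the values on \<open>A\<close> unchanged.\<close>
  define h where "h x = max (-c) (min c (h0 x))" for x
  show ?thesis
  proof (rule that[of h])
    show "continuous_on UNIV h" unfolding h_def by (intro continuous_intros h0)
    show "h x = s i x" if "w i x \<noteq> 0" for i x
    proof -
      have "h0 x = s i x" using that h0(2)[of x] G[OF that] A by auto
      then show ?thesis using bd[of i x] by (auto simp: h_def max_def min_def)
    qed
    have "0 \<le> c" using bd[of 0 undefined] by linarith
    then show "\<bar>h x\<bar> \<le> c" for x by (auto simp: h_def max_def min_def)
  qed
qed

text \<open>Functionals on \<open>C(K)\<close> are applied to plain functions, and only their values on continuous ones
  matter; this gives access to pointwise lattice operations.\<close>

definition bounded_functional :: "real \<Rightarrow> (('k::topological_space \<Rightarrow> real) \<Rightarrow> real) \<Rightarrow> bool" where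
  "bounded_functional C L \<longleftrightarrow>
     (\<forall>f g. continuous_on UNIV f \<longrightarrow> continuous_on UNIV g \<longrightarrow> L (\<lambda>x. f x + g x) = L f + L g) \<and>
     (\<forall>f c. continuous_on UNIV f \<longrightarrow> L (\<lambda>x. c * f x) = c * L f) \<and>
     (\<forall>f b. continuous_on UNIV f \<longrightarrow> (\<forall>x. \<bar>f x\<bar> \<le> b) \<longrightarrow> \<bar>L f\<bar> \<le> C * b)"

context
  fixes C :: real and L :: "('k::topological_space \<Rightarrow> real) \<Rightarrow> real"
  assumes L: "bounded_functional C L"
begin

lemma functional_add:
  "continuous_on UNIV f \<Longrightarrow> continuous_on UNIV g \<Longrightarrow> L (\<lambda>x. f x + g x) = L f + L g"
  using L by (simp add: bounded_functional_def)

lemma functional_cmult: "continuous_on UNIV f \<Longrightarrow> L (\<lambda>x. c * f x) = c * L f"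
  using L by (simp add: bounded_functional_def)

lemma functional_bound: "continuous_on UNIV f \<Longrightarrow> (\<And>x. \<bar>f x\<bar> \<le> b) \<Longrightarrow> \<bar>L f\<bar> \<le> C * b"
  using L by (simp add: bounded_functional_def)

lemma functional_zero: "L (\<lambda>x. 0) = 0"
  using functional_cmult[of "\<lambda>x. 0" 0] by simp

lemma functional_uminus: "continuous_on UNIV f \<Longrightarrow> L (\<lambda>x. - f x) = - L f"
  using functional_cmult[of f "-1"] by simp

lemma functional_diff:
  "continuous_on UNIV f \<Longrightarrow> continuous_on UNIV g \<Longrightarrow> L (\<lambda>x. f x - g x) = L f - L g"
  using functional_add[of f "\<lambda>x. - g x"] functional_uminus[of g] by (simp add: continuous_on_minus)

lemma functional_sum:
  "finite I \<Longrightarrow> (\<And>i. i \<in> I \<Longrightarrow> continuous_on UNIV (f i)) \<Longrightarrow> L (\<lambda>x. \<Sum>i\<in>I. f i x) = (\<Sum>i\<in>I. L (f i))"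
proof (induction rule: finite_induct)
  case empty then show ?case by (simp add: functional_zero)
next
  case (insert a I)
  then show ?case using functional_add[of "f a" "\<lambda>x. \<Sum>i\<in>I. f i x"]
    by (simp add: continuous_on_sum)
qed

text \<open>The signs \<open>sgn (L (f i))\<close> turn the sum into the value of \<open>L\<close>
  at one function bounded by 1. In particular, \<open>\<bar>L v\<bar> > e\<close> is possible for at
  most \<open>C / e\<close> members \<open>v\<close> of a disjoint family bounded by 1.\<close>

lemma sum_abs_functional_le:
  assumes "finite I" "\<And>i. i \<in> I \<Longrightarrow> continuous_on UNIV (f i)" "\<And>x. (\<Sum>i\<in>I. \<bar>f i x\<bar>) \<le> 1"
  shows "(\<Sum>i\<in>I. \<bar>L (f i)\<bar>) \<le> C"
proof -
  have "(\<Sum>i\<in>I. \<bar>L (f i)\<bar>) = (\<Sum>i\<in>I. L (\<lambda>x. sgn (L (f i)) * f i x))"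
  proof (rule sum.cong)
    fix i assume "i \<in> I"
    then show "\<bar>L (f i)\<bar> = L (\<lambda>x. sgn (L (f i)) * f i x)"
      using assms(2) by (simp add: functional_cmult sgn_if)
  qed simp
  also have "\<dots> = L (\<lambda>x. \<Sum>i\<in>I. sgn (L (f i)) * f i x)"
    by (rule functional_sum[symmetric]) (use assms in \<open>auto intro!: continuous_intros\<close>)
  also have "\<dots> \<le> \<bar>L (\<lambda>x. \<Sum>i\<in>I. sgn (L (f i)) * f i x)\<bar>" by simp
  also have "\<dots> \<le> C * 1"
  proof (rule functional_bound)
    show "continuous_on UNIV (\<lambda>x. \<Sum>i\<in>I. sgn (L (f i)) * f i x)"
      using assms by (auto intro!: continuous_intros)
    fix x
    have "\<bar>\<Sum>i\<in>I. sgn (L (f i)) * f i x\<bar> \<le> (\<Sum>i\<in>I. \<bar>sgn (L (f i)) * f i x\<bar>)" by (rule sum_abs)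
    also have "\<dots> \<le> (\<Sum>i\<in>I. \<bar>f i x\<bar>)"
      by (rule sum_mono) (auto simp: abs_mult sgn_if)
    finally show "\<bar>\<Sum>i\<in>I. sgn (L (f i)) * f i x\<bar> \<le> 1" using assms(3)[of x] by linarith
  qed
  finally show ?thesis by simp
qed

end

section \<open>Disjoint sequences and the gliding hump\<close>

lemma sum_disjoint_le:
  fixes f :: "'i \<Rightarrow> real"
  assumes "finite I" "0 \<le> c" "\<And>i. i \<in> I \<Longrightarrow> f i \<le> c"
    "\<And>i j. i \<in> I \<Longrightarrow> j \<in> I \<Longrightarrow> i \<noteq> j \<Longrightarrow> f i = 0 \<or> f j = 0"
  shows "sum f I \<le> c"
proof (cases "\<exists>i\<in>I. f i \<noteq> 0")
  case True
  then obtain i where i: "i \<in> I" "f i \<noteq> 0" by blast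
  have "sum f I = sum f {i}"
    by (rule sum.mono_neutral_right) (use assms i in auto)
  then show ?thesis using assms i by simp
qed (use assms in simp)

text \<open>Cut the enumeration of \<open>S\<close> into \<open>r > C / e\<close> residue classes.
  Gluing constants gives a continuous \<open>c\<close> with value \<open>j\<close> wherever a
  function of class \<open>j\<close> is nonzero, and the bumps \<open>b j\<close> around these
  values have sum at most 1. If every \<open>b j\<close> dominated some \<open>v\<close> with
  \<open>\<bar>L v\<bar> > e\<close>, the total would exceed \<open>C\<close>; so one class and its
  bump serve as \<open>T\<close> and \<open>f\<close>.\<close>

lemma F_space_small_subfamily:
  fixes u :: "nat \<Rightarrow> 'k::topological_space \<Rightarrow> real"
  assumes F: "F_space (euclidean :: 'k topology)" and L: "bounded_functional C L"
    and u: "\<And>i. continuous_on UNIV (u i)" and disj: "\<And>i j x. i \<noteq> j \<Longrightarrow> u i x = 0 \<or> u j x = 0"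
    and "0 < e" and S: "infinite S"
  obtains T f where "infinite T" "T \<subseteq> S" "continuous_on UNIV f" "\<And>x. 0 \<le> f x"
    "\<And>n x. n \<in> T \<Longrightarrow> u n x \<noteq> 0 \<Longrightarrow> f x = 1"
    "\<And>v. continuous_on UNIV v \<Longrightarrow> (\<And>x. \<bar>v x\<bar> \<le> f x) \<Longrightarrow> \<bar>L v\<bar> \<le> e"
proof -
  define q where "q = enumerate S"
  have q: "strict_mono q" "range q = S"
    using S by (auto simp: q_def strict_mono_enumerate range_enumerate)
  then have injq: "inj q" by (simp add: strict_mono_imp_inj_on)
  obtain r :: nat where r: "C / e < real r" using reals_Archimedean2 by blast
  have C0: "0 \<le> C" using functional_bound[OF L, of "\<lambda>x. 0" 1] by simp
  have rC: "C < real r * e" using r \<open>0 < e\<close> by (simp add: field_simps)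
  then have "r > 0" using C0 by (cases r) auto
  obtain c where c: "continuous_on UNIV c" "\<And>i x. u (q i) x \<noteq> 0 \<Longrightarrow> c x = real (i mod r)"
  proof (rule F_space_glue[OF F, of "\<lambda>i. u (q i)" "\<lambda>i x. real (i mod r)" "real r"])
    fix i j x assume "u (q i) x \<noteq> 0" "u (q j) x \<noteq> 0"
    then have "q i = q j" using disj by blast
    then show "real (i mod r) = real (j mod r)" using injq by (simp add: inj_eq)
  qed (use u \<open>r > 0\<close> less_imp_le in auto)
  \<comment> \<open>Tents of radius 1/2 in the value of \<open>c\<close>: distinct ones are
    disjoint, and \<open>b j\<close> is 1 where \<open>c\<close> equals \<open>j\<close>.\<close>
  define b where "b j x = max 0 (1 - 2 * \<bar>c x - real j\<bar>)" for j x
  have contb: "continuous_on UNIV (b j)" for j unfolding b_def by (intro continuous_intros c)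
  have bsum: "(\<Sum>j<r. b j x) \<le> 1" for x
  proof (rule sum_disjoint_le)
    fix i j :: nat assume "i \<noteq> j"
    then have "\<bar>real i - real j\<bar> \<ge> 1" by linarith
    then show "b i x = 0 \<or> b j x = 0" unfolding b_def by (smt (verit))
  qed (auto simp: b_def)
  have "\<exists>j<r. \<forall>v. continuous_on UNIV v \<longrightarrow> (\<forall>x. \<bar>v x\<bar> \<le> b j x) \<longrightarrow> \<bar>L v\<bar> \<le> e"
  proof (rule ccontr)
    assume "\<not> ?thesis"
    then have "\<forall>j. \<exists>v. j < r \<longrightarrow> continuous_on UNIV v \<and> (\<forall>x. \<bar>v x\<bar> \<le> b j x) \<and> \<bar>L v\<bar> > e"
      by (meson not_le)
    then obtain v where v: "\<And>j. j < r \<Longrightarrow> continuous_on UNIV (v j)"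
      "\<And>j x. j < r \<Longrightarrow> \<bar>v j x\<bar> \<le> b j x" "\<And>j. j < r \<Longrightarrow> \<bar>L (v j)\<bar> > e"
      by metis
    have "(\<Sum>j<r. \<bar>L (v j)\<bar>) \<le> C"
    proof (rule sum_abs_functional_le[OF L])
      fix x
      have "(\<Sum>j<r. \<bar>v j x\<bar>) \<le> (\<Sum>j<r. b j x)" by (rule sum_mono) (use v in auto)
      then show "(\<Sum>j<r. \<bar>v j x\<bar>) \<le> 1" using bsum[of x] by linarith
    qed (use v in auto)
    moreover have "real r * e \<le> (\<Sum>j<r. \<bar>L (v j)\<bar>)"
      using sum_bounded_below[of "{..<r}" e "\<lambda>j. \<bar>L (v j)\<bar>"] v(3) by (simp add: less_imp_le)
    ultimately show False using rC by linarith
  qed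
  then obtain j where j: "j < r"
    "\<And>v. continuous_on UNIV v \<Longrightarrow> (\<And>x. \<bar>v x\<bar> \<le> b j x) \<Longrightarrow> \<bar>L v\<bar> \<le> e" by blast
  have "infinite (range (\<lambda>k. q (k * r + j)))"
    by (rule range_inj_infinite) (use \<open>r > 0\<close> in \<open>auto simp: inj_def dest!: injD[OF injq]\<close>)
  moreover have "b j x = 1" if "u (q (k * r + j)) x \<noteq> 0" for k x
    using c(2)[OF that] j(1) by (simp add: b_def)
  ultimately show ?thesis
    using that[of "range (\<lambda>k. q (k * r + j))" "b j"] q(2) contb j(2) by (auto simp: b_def)
qed

text \<open>Otherwise all \<open>\<bar>L n (u n)\<bar>\<close> are at least \<open>d\<close>. Humps
  \<open>u (m i)\<close> are chosen such that \<open>L (m i)\<close> nearly ignores the earlier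
  humps as well as everything below \<open>f i\<close>, and \<open>f i\<close> is 1 wherever a later
  hump is nonzero. Gluing the partial sums of the humps yields a single \<open>h\<close> with
  \<open>\<bar>L (m i) h\<bar> \<ge> d / 2\<close> for all \<open>i\<close>, against
  \<open>null\<close>.\<close>

lemma F_space_gliding_hump:
  fixes u :: "nat \<Rightarrow> 'k::topological_space \<Rightarrow> real"
  assumes F: "F_space (euclidean :: 'k topology)" and L: "\<And>n. bounded_functional C (L n)"
    and null: "\<And>f. continuous_on UNIV f \<Longrightarrow> (\<lambda>n. L n f) \<longlonglongrightarrow> 0"
    and u: "\<And>i. continuous_on UNIV (u i)" and disj: "\<And>i j x. i \<noteq> j \<Longrightarrow> u i x = 0 \<or> u j x = 0"
    and u1: "\<And>i x. \<bar>u i x\<bar> \<le> 1" and "0 < d"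
  shows "\<exists>n. \<bar>L n (u n)\<bar> < d"
proof (rule ccontr)
  assume "\<not> ?thesis"
  then have big: "d \<le> \<bar>L n (u n)\<bar>" for n by (meson not_le)
  \<comment> \<open>The state after choosing hump \<open>m\<close>: \<open>T\<close> holds the
    remaining candidates and \<open>f\<close> is 1 wherever one of them is nonzero. The last clause
    makes \<open>u m\<close> negligible for all later functionals; its geometric factors add up to
    at most \<open>d / 4\<close>.\<close>
  define good where "good i m T f \<longleftrightarrow> infinite T \<and> (\<forall>n\<in>T. m < n) \<and> continuous_on UNIV f \<and> (\<forall>x. 0 \<le> f x) \<and>
     (\<forall>n\<in>T. \<forall>x. u n x \<noteq> 0 \<longrightarrow> f x = 1) \<and>
     (\<forall>v. continuous_on UNIV v \<longrightarrow> (\<forall>x. \<bar>v x\<bar> \<le> f x) \<longrightarrow> \<bar>L m v\<bar> \<le> d / 16) \<and>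
     (\<forall>n\<in>T. \<bar>L n (u m)\<bar> \<le> d / 4 * (1/2) ^ Suc i)"
    for i :: nat and m T and f :: "'k \<Rightarrow> real"
  have step: "\<exists>m T f. m \<in> S \<and> T \<subseteq> S \<and> good i m T f" if S: "infinite S" for S i
  proof -
    obtain m where m: "m \<in> S" using S by fastforce
    have "\<forall>\<^sub>F n in sequentially. \<bar>L n (u m)\<bar> < d / 4 * (1/2) ^ Suc i"
      using tendstoD[OF null[OF u, of m], of "d / 4 * (1/2) ^ Suc i"] \<open>0 < d\<close> by simp
    then obtain N where N: "\<And>n. N \<le> n \<Longrightarrow> \<bar>L n (u m)\<bar> < d / 4 * (1/2) ^ Suc i"
      by (auto simp: eventually_sequentially)
    have inf: "infinite (S - {..max m N})" using S by simp
    obtain T f where T: "infinite T" "T \<subseteq> S - {..max m N}" "continuous_on UNIV f" "\<And>x. 0 \<le> f x"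
      "\<And>n x. n \<in> T \<Longrightarrow> u n x \<noteq> 0 \<Longrightarrow> f x = 1"
      "\<And>v. continuous_on UNIV v \<Longrightarrow> (\<And>x. \<bar>v x\<bar> \<le> f x) \<Longrightarrow> \<bar>L m v\<bar> \<le> d / 16"
    proof (rule F_space_small_subfamily[OF F L[of m], where u = u and e = "d / 16" and S = "S - {..max m N}"])
      show "0 < d / 16" using \<open>0 < d\<close> by simp
      fix T f
      assume "infinite T" "T \<subseteq> S - {..max m N}" "continuous_on UNIV f" "\<And>x. 0 \<le> f x"
        "\<And>n x. n \<in> T \<Longrightarrow> u n x \<noteq> 0 \<Longrightarrow> f x = 1"
        "\<And>v. continuous_on UNIV v \<Longrightarrow> (\<And>x. \<bar>v x\<bar> \<le> f x) \<Longrightarrow> \<bar>L m v\<bar> \<le> d / 16"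
      then show thesis by (rule that)
    qed (rule u, erule disj, rule inf)
    have mN: "m < n" "N \<le> n" if "n \<in> T" for n using subsetD[OF T(2) that] by auto
    have "\<bar>L m v\<bar> \<le> d / 16" if "continuous_on UNIV v" "\<forall>x. \<bar>v x\<bar> \<le> f x" for v
      by (rule T(6)) (use that in auto)
    moreover have "\<bar>L n (u m)\<bar> \<le> d / 4 * (1/2) ^ Suc i" if "n \<in> T" for n
      using N[OF mN(2)[OF that]] by (rule less_imp_le)
    ultimately have "good i m T f"
      unfolding good_def using T(1,3-5) mN(1) by (intro conjI) blast+
    moreover have "T \<subseteq> S" using T(2) by auto
    ultimately show ?thesis using m by (intro exI[of _ m] exI[of _ T] exI[of _ f]) simp
  qed
  \<comment> \<open>The next hump is drawn from the current \<open>T\<close>, and the sets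
    \<open>T\<close> are nested, so every later hump inherits the estimates stated for members of
    \<open>T\<close>.\<close>
  have "\<exists>s. \<forall>i. (case s i of (m, T, f) \<Rightarrow> good i m T f) \<and>
      (case s i of (m, T, f) \<Rightarrow> case s (Suc i) of (m', T', f') \<Rightarrow> m' \<in> T \<and> T' \<subseteq> T)"
  proof (rule dependent_nat_choice)
    show "\<exists>x. case x of (m, T, f) \<Rightarrow> good 0 m T f" using step[of UNIV 0] by auto
    show "\<exists>y. (case y of (m, T, f) \<Rightarrow> good (Suc i) m T f) \<and>
        (case x of (m, T, f) \<Rightarrow> case y of (m', T', f') \<Rightarrow> m' \<in> T \<and> T' \<subseteq> T)"
      if "case x of (m, T, f) \<Rightarrow> good i m T f" for x i
    proof (cases x)
      case (fields m T f)
      then have "infinite T" using that by (simp add: good_def)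
      then obtain m' T' f' where "m' \<in> T" "T' \<subseteq> T" "good (Suc i) m' T' f'" using step by blast
      then show ?thesis using fields by (intro exI[of _ "(m', T', f')"]) simp
    qed
  qed
  then obtain s where s: "\<forall>i. (case s i of (m, T, f) \<Rightarrow> good i m T f) \<and>
      (case s i of (m, T, f) \<Rightarrow> case s (Suc i) of (m', T', f') \<Rightarrow> m' \<in> T \<and> T' \<subseteq> T)" by (rule exE)
  define m where "m i = fst (s i)" for i
  define T where "T i = fst (snd (s i))" for i
  define f where "f i = snd (snd (s i))" for i
  have good: "good i (m i) (T i) (f i)" for i
    using spec[OF s, of i] by (simp add: m_def T_def f_def split: prod.splits)
  note good = good[unfolded good_def]
  have contf: "continuous_on UNIV (f i)" and f0: "0 \<le> f i x" for i x
    using good[of i] by blast+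
  have f1: "f i x = 1" if "n \<in> T i" "u n x \<noteq> 0" for i n x
    using good[of i] that by blast
  have small: "\<bar>L (m i) v\<bar> \<le> d / 16" if "continuous_on UNIV v" "\<And>x. \<bar>v x\<bar> \<le> f i x" for i v
    using good[of i] that by blast
  have cross: "\<bar>L n (u (m i))\<bar> \<le> d / 4 * (1/2) ^ Suc i" and mT: "m i < n" if "n \<in> T i" for i n
    using good[of i] that by blast+
  have next_in: "m (Suc i) \<in> T i" and sub: "T (Suc i) \<subseteq> T i" for i
    using spec[OF s, of i] by (auto simp: m_def T_def split: prod.splits)
  have mono: "T j \<subseteq> T i" if "i \<le> j" for i j
    using lift_Suc_antimono_le[of T, OF sub that] .
  have later: "m j \<in> T i" if "i < j" for i j
    using that next_in[of "j - 1"] mono[of i "j - 1"] by (cases j) auto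
  have lt: "m i < m j" if "i < j" for i j using mT later[OF that] by blast
  have ne: "m i \<noteq> m j" if "i \<noteq> j" for i j using lt[of i j] lt[of j i] that by linarith
  \<comment> \<open>Where \<open>f i < 1/2\<close> no \<open>u (m j)\<close> with \<open>j > i\<close> lives, so \<open>p i\<close> can be prescribed for \<open>h\<close> there as well.
    Hence \<open>\<bar>h - p i\<bar> \<le> 4 * f i\<close> on the whole space, although \<open>h\<close> is otherwise uncontrolled
    off the sets where the \<open>u (m j)\<close> live.\<close>
  define p where "p i x = (\<Sum>j\<le>i. u (m j) x)" for i x
  define w where "w i x = \<bar>u (m i) x\<bar> + max 0 (1/2 - f i x)" for i x
  have contp: "continuous_on UNIV (p i)" for i unfolding p_def by (intro continuous_intros u)
  have p1: "\<bar>p i x\<bar> \<le> 1" for i x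
  proof -
    have "\<bar>p i x\<bar> \<le> (\<Sum>j\<le>i. \<bar>u (m j) x\<bar>)" unfolding p_def by (rule sum_abs)
    also have "\<dots> \<le> 1" by (rule sum_disjoint_le) (use u1 disj ne in auto)
    finally show ?thesis .
  qed
  have vanish: "u (m j) x = 0" if "w i x \<noteq> 0" "i < j" for i j x
  proof (cases "u (m i) x = 0")
    case True
    then have "f i x < 1/2" using that by (auto simp: w_def max_def split: if_splits)
    then show ?thesis using f1[OF later[OF that(2)], of x] by auto
  next
    case False
    then show ?thesis using disj[OF ne[of i j], of x] that(2) by simp
  qed
  have stable: "p j x = p i x" if "w i x \<noteq> 0" "i \<le> j" for i j x
    unfolding p_def by (rule sum.mono_neutral_right) (use vanish[OF that(1)] that in auto)
  obtain h where h: "continuous_on UNIV h" "\<And>i x. w i x \<noteq> 0 \<Longrightarrow> h x = p i x" "\<And>x. \<bar>h x\<bar> \<le> 1"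
  proof (rule F_space_glue[OF F, of w p 1])
    show "continuous_on UNIV (w i)" for i unfolding w_def by (intro continuous_intros u contf)
    show "p i x = p j x" if "w i x \<noteq> 0" "w j x \<noteq> 0" for i j x
      using stable[OF that(1), of j] stable[OF that(2), of i] by (cases "i \<le> j") auto
  qed (rule contp, rule p1, rule that)
  \<comment> \<open>Split \<open>h\<close> into \<open>h - p i\<close>, the humps before
    \<open>m i\<close>, and \<open>u (m i)\<close>. The first part contributes at most four times
    \<open>d / 16\<close>, the second at most \<open>d / 4\<close>, so \<open>d / 2\<close> of the
    last one survives.\<close>
  have lower: "d / 2 \<le> \<bar>L (m i) h\<bar>" for i
  proof -
    let ?L = "L (m i)"
    have rem: "\<bar>(1/4) * (h x - p i x)\<bar> \<le> f i x" for x
    proof (cases "f i x < 1/2")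
      case True
      then have "w i x \<noteq> 0" by (auto simp: w_def max_def)
      then show ?thesis using h(2) f0 by simp
    next
      case False
      then show ?thesis using h(3)[of x] p1[of i x] by auto
    qed
    have "\<bar>?L (\<lambda>x. (1/4) * (h x - p i x))\<bar> \<le> d / 16"
      by (rule small[OF _ rem]) (intro continuous_intros h contp)
    moreover have "?L (\<lambda>x. (1/4) * (h x - p i x)) = (1/4) * (?L h - ?L (p i))"
      using functional_cmult[OF L, of "\<lambda>x. h x - p i x" "m i" "1/4"] functional_diff[OF L h(1) contp]
      by (simp add: continuous_on_diff h(1) contp)
    ultimately have "\<bar>(1/4) * (?L h - ?L (p i))\<bar> \<le> d / 16" by (simp only:)
    then have r: "\<bar>?L h - ?L (p i)\<bar> \<le> d / 4" unfolding abs_mult by simp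
    have "?L (p i) = (\<Sum>j\<le>i. ?L (u (m j)))"
      unfolding p_def by (rule functional_sum[OF L]) (use u in auto)
    also have "\<dots> = (\<Sum>j<i. ?L (u (m j))) + ?L (u (m i))"
      by (simp add: lessThan_Suc_atMost[symmetric])
    finally have eq: "?L (p i) = (\<Sum>j<i. ?L (u (m j))) + ?L (u (m i))" .
    have "\<bar>\<Sum>j<i. ?L (u (m j))\<bar> \<le> (\<Sum>j<i. d / 4 * (1/2) ^ Suc j)"
      by (rule order.trans[OF sum_abs]) (intro sum_mono cross later, simp)
    also have "\<dots> = d / 4 * (\<Sum>j<i. (1/2) ^ Suc j)" by (rule sum_distrib_left[symmetric])
    also have "\<dots> = d / 4 * (1 - (1/2)^i)"
    proof -
      have "(\<Sum>j<i. (1/2::real) ^ Suc j) = 1 - (1/2)^i" by (induction i) auto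
      then show ?thesis by simp
    qed
    also have "\<dots> \<le> d / 4" using \<open>0 < d\<close> by (simp add: algebra_simps)
    finally show ?thesis using r eq big[of "m i"] by linarith
  qed
  have "strict_mono m" using lt by (simp add: strict_mono_def)
  then have "(\<lambda>i. L (m i) h) \<longlonglongrightarrow> 0"
    using LIMSEQ_subseq_LIMSEQ[OF null[OF h(1)]] by (simp add: o_def)
  then have "\<forall>\<^sub>F i in sequentially. \<bar>L (m i) h\<bar> < d / 2"
    using \<open>0 < d\<close> tendstoD[of _ 0 sequentially "d / 2"] by force
  then obtain i where "\<bar>L (m i) h\<bar> < d / 2" by (auto simp: eventually_sequentially)
  then show False using lower[of i] by linarith
qed


section \<open>From disjoint to monotone and pointwise null sequences\<close>

text \<open>This is \<open>p(f) \<le> e\<close> for the gauge \<open>p\<close> of the overview,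
  expressed without forming the supremum.\<close>

definition uniformly_small ::
    "(nat \<Rightarrow> ('k::topological_space \<Rightarrow> real) \<Rightarrow> real) \<Rightarrow> ('k \<Rightarrow> real) \<Rightarrow> real \<Rightarrow> bool" where
  "uniformly_small L f e \<longleftrightarrow>
     (\<forall>n v. continuous_on UNIV v \<longrightarrow> (\<forall>x. \<bar>v x\<bar> \<le> f x) \<longrightarrow> \<bar>L n v\<bar> \<le> e)"

lemma uniformly_small_mono:
  assumes "uniformly_small L f e" "\<And>x. g x \<le> f x" "e \<le> e'"
  shows "uniformly_small L g e'"
  using assms unfolding uniformly_small_def by (meson order_trans)

context
  fixes C :: real and L :: "nat \<Rightarrow> ('k::topological_space \<Rightarrow> real) \<Rightarrow> real"
  assumes L: "\<And>n. bounded_functional C (L n)"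
begin

text \<open>Subadditivity of the gauge by Riesz decomposition: clipping \<open>v\<close> to values
  between \<open>- f\<close> and \<open>f\<close> leaves a remainder bounded by
  \<open>g\<close>.\<close>

lemma uniformly_small_add:
  assumes "uniformly_small L f a" "uniformly_small L g b" "continuous_on UNIV f"
    "\<And>x. 0 \<le> f x" "\<And>x. 0 \<le> g x"
  shows "uniformly_small L (\<lambda>x. f x + g x) (a + b)"
  unfolding uniformly_small_def
proof (intro allI impI)
  fix n v assume v: "continuous_on UNIV v" "\<forall>x. \<bar>v x\<bar> \<le> f x + g x"
  define v1 where "v1 x = max (- f x) (min (f x) (v x))" for x
  have c1: "continuous_on UNIV v1" unfolding v1_def by (intro continuous_intros assms v)
  have "\<bar>v1 x\<bar> \<le> f x" "\<bar>v x - v1 x\<bar> \<le> g x" for x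
    using v(2)[rule_format, of x] assms(4)[of x] assms(5)[of x] unfolding v1_def by (smt (verit))+
  moreover have "continuous_on UNIV (\<lambda>x. v x - v1 x)" by (intro continuous_intros v c1)
  ultimately have "\<bar>L n v1\<bar> \<le> a" "\<bar>L n (\<lambda>x. v x - v1 x)\<bar> \<le> b"
    using assms(1,2) c1 unfolding uniformly_small_def by blast+
  then show "\<bar>L n v\<bar> \<le> a + b" using functional_diff[OF L v(1) c1, of n] by linarith
qed

lemma uniformly_small_scale:
  assumes "uniformly_small L f a" "0 < c"
  shows "uniformly_small L (\<lambda>x. c * f x) (c * a)"
  unfolding uniformly_small_def
proof (intro allI impI)
  fix n v assume v: "continuous_on UNIV v" "\<forall>x. \<bar>v x\<bar> \<le> c * f x"
  have "\<bar>inverse c * v x\<bar> \<le> f x" for x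
    using v(2)[rule_format, of x] \<open>0 < c\<close> by (simp add: abs_mult field_simps)
  moreover have "continuous_on UNIV (\<lambda>x. inverse c * v x)" by (intro continuous_intros v)
  ultimately have "\<bar>L n (\<lambda>x. inverse c * v x)\<bar> \<le> a"
    using assms(1) unfolding uniformly_small_def by blast
  moreover have "\<bar>L n v\<bar> = c * \<bar>L n (\<lambda>x. inverse c * v x)\<bar>"
    using functional_cmult[OF L v(1), of n "inverse c"] \<open>0 < c\<close> by (simp add: abs_mult)
  ultimately show "\<bar>L n v\<bar> \<le> c * a" using \<open>0 < c\<close> by simp
qed

lemma uniformly_small_bound:
  assumes "\<And>x. f x \<le> b"
  shows "uniformly_small L f (C * b)"
  unfolding uniformly_small_def
  by (intro allI impI functional_bound[OF L]) (use assms in \<open>auto intro: order_trans\<close>)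

lemma uniformly_small_sum:
  assumes "finite I" "\<And>i. i \<in> I \<Longrightarrow> uniformly_small L (f i) (a i)"
    "\<And>i. i \<in> I \<Longrightarrow> continuous_on UNIV (f i)" "\<And>i x. i \<in> I \<Longrightarrow> 0 \<le> f i x"
  shows "uniformly_small L (\<lambda>x. \<Sum>i\<in>I. f i x) (\<Sum>i\<in>I. a i)"
  using assms
proof (induction rule: finite_induct)
  case empty
  show ?case using uniformly_small_bound[of "\<lambda>x. 0" 0] by simp
next
  case (insert i I)
  then have "uniformly_small L (\<lambda>x. f i x + (\<Sum>i\<in>I. f i x)) (a i + (\<Sum>i\<in>I. a i))"
    by (intro uniformly_small_add) (auto intro!: sum_nonneg)
  then show ?case using insert by simp
qed

context
  assumes F: "F_space (euclidean :: 'k topology)"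
    and null: "\<And>f. continuous_on UNIV f \<Longrightarrow> (\<lambda>n. L n f) \<longlonglongrightarrow> 0"
begin

text \<open>Otherwise each \<open>q i\<close> dominates some \<open>v i\<close> on which a
  functional \<open>L (k i)\<close> exceeds \<open>e\<close>. One functional can do so for at most
  \<open>C / e\<close> of the disjoint \<open>v i\<close>, so \<open>k\<close> tends to infinity.
  Hence the reindexed functionals \<open>L (k i)\<close> are again weak* null, and the gliding hump
  applies to them and the \<open>v i\<close>.\<close>

lemma uniformly_small_disjoint:
  fixes q :: "nat \<Rightarrow> 'k \<Rightarrow> real"
  assumes q: "\<And>i. continuous_on UNIV (q i)" "\<And>i x. 0 \<le> q i x" "\<And>i x. q i x \<le> 1"
    and disj: "\<And>i j x. i \<noteq> j \<Longrightarrow> q i x = 0 \<or> q j x = 0" and "0 < e"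
  shows "\<exists>i. uniformly_small L (q i) e"
proof (rule ccontr)
  assume "\<not> ?thesis"
  then have "\<forall>i. \<exists>k v. continuous_on UNIV v \<and> (\<forall>x. \<bar>v x\<bar> \<le> q i x) \<and> e < \<bar>L k v\<bar>"
    unfolding uniformly_small_def by (meson not_le)
  then obtain k v where v: "\<And>i. continuous_on UNIV (v i)" "\<And>i x. \<bar>v i x\<bar> \<le> q i x"
    "\<And>i. e < \<bar>L (k i) (v i)\<bar>" by metis
  have v1: "\<bar>v i x\<bar> \<le> 1" for i x using v(2) q(3) order_trans by blast
  have vd: "v i x = 0 \<or> v j x = 0" if "i \<noteq> j" for i j x
    using disj[OF that, of x] v(2)[of i x] v(2)[of j x] by auto
  have fin: "finite {i. k i = n}" for n
  proof (rule ccontr)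
    assume inf: "infinite {i. k i = n}"
    obtain N :: nat where N: "C / e < real N" using reals_Archimedean2 by blast
    obtain I where I: "I \<subseteq> {i. k i = n}" "finite I" "card I = N"
      using infinite_arbitrarily_large[OF inf] by blast
    have "real N * e \<le> (\<Sum>i\<in>I. \<bar>L n (v i)\<bar>)"
      using sum_bounded_below[of I e "\<lambda>i. \<bar>L n (v i)\<bar>"] v(3) I by (force simp: less_imp_le)
    also have "\<dots> \<le> C"
    proof (rule sum_abs_functional_le[OF L I(2)])
      show "(\<Sum>i\<in>I. \<bar>v i x\<bar>) \<le> 1" for x
        by (rule sum_disjoint_le[OF I(2)]) (use v1 vd[of _ _ x] in auto)
    qed (rule v)
    finally show False using N \<open>0 < e\<close> by (simp add: field_simps)
  qed
  have "filterlim k at_top sequentially"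
    unfolding filterlim_at_top
  proof
    fix Z
    have "{i. \<not> Z \<le> k i} = (\<Union>n<Z. {i. k i = n})" by auto
    then have "finite {i. \<not> Z \<le> k i}" using fin by simp
    then show "\<forall>\<^sub>F i in sequentially. Z \<le> k i"
      by (simp add: cofinite_eq_sequentially[symmetric] eventually_cofinite)
  qed
  then have "\<exists>n. \<bar>L (k n) (v n)\<bar> < e"
    by (intro F_space_gliding_hump[OF F, where L = "\<lambda>n. L (k n)"])
      (use L v v1 vd \<open>0 < e\<close> filterlim_compose[OF null] in auto)
  then show False using v(3) by (meson less_asym)
qed

context
  fixes v :: "nat \<Rightarrow> 'k \<Rightarrow> real"
  assumes v: "\<And>i. continuous_on UNIV (v i)" "\<And>i x. 0 \<le> v i x" "\<And>i x. v i x \<le> 1"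
    and decr: "\<And>i j x. i \<le> j \<Longrightarrow> v j x \<le> v i x"
begin

text \<open>The function below lives on \<open>{v n > t} \<inter> {v m < s}\<close>. As the \<open>v n\<close> decrease and \<open>s < t\<close>, these
  regions are disjoint for consecutive pairs \<open>n\<^sub>1 \<le> m\<^sub>1 \<le> n\<^sub>2 \<le> m\<^sub>2 \<le> \<dots>\<close>.\<close>

lemma uniformly_small_gap:
  assumes "0 \<le> s" "s < t" "0 < e"
  shows "\<exists>N. \<forall>n m. N \<le> n \<longrightarrow> n \<le> m \<longrightarrow>
           uniformly_small L (\<lambda>x. min (max 0 (v n x - t)) (max 0 (s - v m x))) e"
proof (rule ccontr)
  define q where "q n m x = min (max 0 (v n x - t)) (max 0 (s - v m x))" for n m x
  assume "\<not> ?thesis"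
  then have "\<forall>N. \<exists>n m. N \<le> n \<and> n \<le> m \<and> \<not> uniformly_small L (q n m) e"
    unfolding q_def by blast
  then obtain n m where nm: "\<And>N. N \<le> n N" "\<And>N. n N \<le> m N"
    "\<And>N. \<not> uniformly_small L (q (n N) (m N)) e" by metis
  \<comment> \<open>Each starting index leaps past the previous \<open>m\<close>, which produces the
    interlaced pairs.\<close>
  define a where "a i = ((\<lambda>N. Suc (m N)) ^^ i) 0" for i
  have a_Suc: "a (Suc i) = Suc (m (a i))" for i by (simp add: a_def)
  have "a i \<le> a (Suc i)" for i using nm(1,2)[of "a i"] by (simp add: a_Suc)
  then have a_mono: "a i \<le> a j" if "i \<le> j" for i j using lift_Suc_mono_le that by blast
  have sep: "m (a i) \<le> n (a j)" if "i < j" for i j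
    using a_mono[of "Suc i" j] that nm(1)[of "a j"] by (simp add: a_Suc)
  have disj: "q (n (a i)) (m (a i)) x = 0 \<or> q (n (a j)) (m (a j)) x = 0" if "i < j" for i j x
    using decr[OF sep[OF that], of x] \<open>s < t\<close> unfolding q_def by (smt (verit))
  have "\<exists>i. uniformly_small L (q (n (a i)) (m (a i))) e"
  proof (rule uniformly_small_disjoint)
    show "continuous_on UNIV (q (n (a i)) (m (a i)))" for i
      unfolding q_def by (intro continuous_intros v)
    show "q (n (a i)) (m (a i)) x \<le> 1" for i x
      using v(3)[of "n (a i)" x] assms by (auto simp: q_def)
    show "q (n (a i)) (m (a i)) x = 0 \<or> q (n (a j)) (m (a j)) x = 0" if "i \<noteq> j" for i j x
      using disj[of i j x] disj[of j i x] that by (meson nat_neq_iff)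
  qed (use \<open>0 < e\<close> in \<open>auto simp: q_def\<close>)
  then show False using nm(3) by blast
qed

text \<open>Cut the range into \<open>J\<close> levels. Where \<open>v N - v m\<close> exceeds
  \<open>4 / J\<close>, some level interval fits between the two values with margin
  \<open>1 / J\<close> on both sides, and there the gap function of that level is at least
  \<open>1 / J\<close>. So \<open>v N - v m\<close> is at most \<open>4 / J\<close> plus
  \<open>J\<close> times the sum of the gap functions; for large \<open>J\<close> and
  \<open>N\<close> each summand costs at most \<open>e / 2\<close>.\<close>

lemma uniformly_small_decreasing:
  assumes "0 < e"
  shows "\<exists>N. \<forall>m\<ge>N. uniformly_small L (\<lambda>x. v N x - v m x) e"
proof -
  have C0: "0 \<le> C" using functional_bound[OF L, of "\<lambda>x. 0" 1 0] by simp
  obtain J :: nat where J0: "8 * C / e + 1 < real J" using reals_Archimedean2 by blast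
  have "0 \<le> 8 * C / e" using C0 \<open>0 < e\<close> by simp
  then have "0 < real J" using J0 by linarith
  moreover have "8 * C < e * real J"
  proof -
    have "8 * C / e < real J" using J0 by linarith
    then show ?thesis using \<open>0 < e\<close> by (simp add: field_simps)
  qed
  ultimately have J: "0 < real J" "C * (4 / real J) \<le> e / 2" by (simp_all add: field_simps)
  let ?q = "\<lambda>j n m x. min (max 0 (v n x - (j + 1) / J)) (max 0 (j / J - v m x))"
  have "\<forall>j. \<exists>N. \<forall>n m. N \<le> n \<longrightarrow> n \<le> m \<longrightarrow> uniformly_small L (?q (real j) n m) (e / (2 * J * J))"
    using J \<open>0 < e\<close> by (intro allI uniformly_small_gap) (auto simp: field_simps)
  then obtain M where M: "\<And>j n m. M j \<le> n \<Longrightarrow> n \<le> m \<Longrightarrow> uniformly_small L (?q (real j) n m) (e / (2 * J * J))"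
    by metis
  define N where "N = (\<Sum>j<J. M j)"
  have MN: "M j \<le> N" if "j < J" for j
    unfolding N_def by (rule member_le_sum) (use that in auto)
  show ?thesis
  proof (intro exI[of _ N] allI impI)
    fix m assume m: "N \<le> m"
    let ?g = "\<lambda>j x. real J * ?q (real j) N m x"
    have "uniformly_small L (?g j) (J * (e / (2 * J * J)))" if "j < J" for j
      by (rule uniformly_small_scale[OF M[OF MN[OF that] m] J(1)])
    then have "uniformly_small L (\<lambda>x. \<Sum>j<J. ?g j x) (\<Sum>j<J. J * (e / (2 * J * J)))"
      by (intro uniformly_small_sum) (auto intro!: continuous_intros v)
    also have "(\<Sum>j<J. J * (e / (2 * J * J))) = e / 2" using J by simp
    finally have "uniformly_small L (\<lambda>x. 4 / J + (\<Sum>j<J. ?g j x)) (C * (4 / J) + e / 2)"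
      by (intro uniformly_small_add uniformly_small_bound) (auto intro!: sum_nonneg)
    then show "uniformly_small L (\<lambda>x. v N x - v m x) e"
    proof (rule uniformly_small_mono)
      show "C * (4 / J) + e / 2 \<le> e" using J by simp
      fix x
      have sum0: "0 \<le> (\<Sum>j<J. ?g j x)" by (intro sum_nonneg) auto
      show "v N x - v m x \<le> 4 / J + (\<Sum>j<J. ?g j x)"
      proof (cases "v N x - v m x \<le> 4 / J")
        case False
        \<comment> \<open>The offset 2 puts \<open>j / J\<close> between one and two levels above
          \<open>v m x\<close>. As \<open>v N x\<close> is more than four levels above it,
          \<open>(j + 1) / J\<close> stays at least one level below \<open>v N x\<close>.\<close>
        define j where "j = nat \<lfloor>v m x * J\<rfloor> + 2"
        have "0 \<le> v m x * J" using v(2)[of m x] by simp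
        then have j: "v m x * J + 1 \<le> j" "j \<le> v m x * J + 2"
          unfolding j_def by linarith+
        have gap: "v m x * J + 4 < v N x * J" using False J by (simp add: field_simps)
        moreover have "v N x * J \<le> J" using v(3)[of N x] J mult_right_mono[of "v N x" 1 "real J"] by simp
        ultimately have "j < J" using j by linarith
        have "1 / J \<le> v N x - (real j + 1) / J" "1 / J \<le> real j / J - v m x"
          using j gap J by (auto simp: field_simps)
        then have "1 / J \<le> ?q (real j) N m x" by (auto simp: le_max_iff_disj)
        then have "1 \<le> ?g j x" using mult_left_mono[of "1 / J" "?q (real j) N m x" "real J"] J by simp
        also have "\<dots> \<le> (\<Sum>j<J. ?g j x)"
          by (rule member_le_sum) (use \<open>j < J\<close> in auto)
        finally show ?thesis using v(2)[of m x] v(3)[of N x] J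
          by (smt (verit) divide_nonneg_nonneg)
      qed (use sum0 in linarith)
    qed
  qed
qed

end

end

end

text \<open>The open sets where \<open>v n < b\<close> increase with \<open>n\<close> and cover a
  compact space, so one of them is the whole space.\<close>

lemma Dini_le:
  fixes v :: "nat \<Rightarrow> 'k::topological_space \<Rightarrow> real"
  assumes K: "compact (UNIV :: 'k set)" and v: "\<And>i. continuous_on UNIV (v i)"
    and decr: "\<And>i j x. i \<le> j \<Longrightarrow> v j x \<le> v i x" and lim: "\<And>x. \<exists>n. v n x < b"
  shows "\<exists>N. \<forall>x. v N x < b"
proof -
  have "open {x. v n x < b}" for n
    by (rule open_Collect_less) (auto intro: v)
  moreover have "UNIV \<subseteq> (\<Union>n\<in>UNIV. {x. v n x < b})" using lim by auto
  ultimately obtain D where D: "finite D" "UNIV \<subseteq> (\<Union>n\<in>D. {x. v n x < b})"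
    using compactE_image[OF K, of UNIV "\<lambda>n. {x. v n x < b}"] by metis
  have "v (Max D) x < b" for x
  proof -
    obtain n where "n \<in> D" "v n x < b" using D(2) by blast
    then show ?thesis using decr[of n "Max D" x] D(1) by (simp add: le_less_trans)
  qed
  then show ?thesis by blast
qed

text \<open>The tail suprema of \<open>h\<close> decrease to 0 but may be discontinuous. They are
  replaced by finite maxima \<open>g n (D n)\<close>, with \<open>D n\<close> so large that
  prolonging the maximum adds only a small amount in the gauge. The running minima
  \<open>v n\<close> of these maxima are continuous and eventually below \<open>b\<close> at each
  point, hence uniformly so by Dini; and \<open>h n\<close> is at most \<open>v n\<close> plus the
  sum of the prolongation errors.\<close>

lemma uniformly_small_pointwise_null:
  fixes h :: "nat \<Rightarrow> 'k::topological_space \<Rightarrow> real"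
  assumes K: "compact (UNIV :: 'k set)" and F: "F_space (euclidean :: 'k topology)"
    and L: "\<And>n. bounded_functional C (L n)"
    and null: "\<And>f. continuous_on UNIV f \<Longrightarrow> (\<lambda>n. L n f) \<longlonglongrightarrow> 0"
    and h: "\<And>i. continuous_on UNIV (h i)" "\<And>i x. 0 \<le> h i x" "\<And>i x. h i x \<le> 1"
    and lim: "\<And>x. (\<lambda>i. h i x) \<longlonglongrightarrow> 0" and "0 < e"
  shows "\<exists>n. uniformly_small L (h n) e"
proof -
  \<comment> \<open>\<open>g n d\<close> is the maximum of \<open>h n\<close>, ...,
    \<open>h (n + d)\<close>.\<close>
  define g where "g n = rec_nat (h n) (\<lambda>d f x. max (f x) (h (Suc (n + d)) x))" for n
  have g_0: "g n 0 = h n" and g_Suc: "g n (Suc d) = (\<lambda>x. max (g n d x) (h (Suc (n + d)) x))" for n d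
    by (simp_all add: g_def)
  have gc: "continuous_on UNIV (g n d)" for n d
    by (induction d) (auto simp: g_0 g_Suc intro!: continuous_intros h)
  have h_le_g: "h k x \<le> g n d x" if "n \<le> k" "k \<le> n + d" for n d k x
    using that by (induction d) (auto simp: g_0 g_Suc le_Suc_eq le_max_iff_disj)
  have g_le: "g n d x \<le> b" if "\<And>k. n \<le> k \<Longrightarrow> k \<le> n + d \<Longrightarrow> h k x \<le> b" for n d x b
    using that by (induction d) (auto simp: g_0 g_Suc)
  have g_mono: "g n d x \<le> g i D x" if "i \<le> n" "n + d \<le> i + D" for n d i D x
    by (rule g_le) (rule h_le_g, use that in auto)
  have g0: "0 \<le> g n d x" for n d x using h(2)[of n x] h_le_g[of n n d x] by linarith
  have g1: "g n d x \<le> 1" for n d x by (rule g_le) (rule h)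
  have "\<forall>n. \<exists>D. \<forall>d\<ge>D. uniformly_small L (\<lambda>x. (1 - g n D x) - (1 - g n d x)) (e * (1/2) ^ (n + 2))"
    by (intro allI uniformly_small_decreasing[OF L F null, where v = "\<lambda>d x. 1 - g _ d x"])
      (use g0 g1 g_mono \<open>0 < e\<close> in \<open>auto intro!: continuous_intros gc\<close>)
  then obtain D where D: "\<And>n d. D n \<le> d \<Longrightarrow> uniformly_small L (\<lambda>x. g n d x - g n (D n) x) (e * (1/2) ^ (n + 2))"
    by (auto simp: algebra_simps) metis
  \<comment> \<open>Running minima are taken because \<open>g n (D n)\<close> need not decrease in
    \<open>n\<close>: the windows of indices are not nested.\<close>
  define v where "v = rec_nat (g 0 (D 0)) (\<lambda>n f x. min (f x) (g (Suc n) (D (Suc n)) x))"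
  have v_0: "v 0 = g 0 (D 0)" and v_Suc: "v (Suc n) = (\<lambda>x. min (v n x) (g (Suc n) (D (Suc n)) x))" for n
    by (simp_all add: v_def)
  have vc: "continuous_on UNIV (v n)" for n
    by (induction n) (auto simp: v_0 v_Suc intro!: continuous_intros gc)
  have v_decr: "v j x \<le> v i x" if "i \<le> j" for i j x
    using lift_Suc_antimono_le[of "\<lambda>n. v n x", OF _ that] by (simp add: v_Suc)
  have v_attained: "\<exists>i\<le>n. v n x = g i (D i) x" for n x
  proof (induction n)
    case (Suc n)
    then obtain i where "i \<le> n" "v n x = g i (D i) x" by blast
    then show ?case by (cases "v n x \<le> g (Suc n) (D (Suc n)) x") (auto simp: v_Suc min_def intro: le_SucI)
  qed (simp add: v_0)
  have v_le: "v n x \<le> g n (D n) x" for n x by (cases n) (auto simp: v_0 v_Suc)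
  have v0: "0 \<le> v n x" for n x using v_attained[of n x] g0 by auto
  have C0: "0 \<le> C" using functional_bound[OF L, of "\<lambda>x. 0" 1 0] by simp
  define b where "b = e / (2 * (C + 1))"
  have b: "0 < b" "C * b \<le> e / 2" using C0 \<open>0 < e\<close> by (auto simp: b_def field_simps)
  have "\<exists>n. v n x < b" for x
  proof -
    have "\<forall>\<^sub>F i in sequentially. h i x < b / 2"
      using order_tendstoD(2)[OF lim, of "b / 2" x] b by simp
    then obtain n where "\<And>i. n \<le> i \<Longrightarrow> h i x < b / 2" by (auto simp: eventually_sequentially)
    then have "g n (D n) x \<le> b / 2" by (intro g_le) (auto simp: less_imp_le)
    then show ?thesis using v_le[of n x] b by (intro exI[of _ n]) linarith
  qed
  then have "\<exists>n. \<forall>x. v n x < b" by (intro Dini_le[OF K vc]) (auto intro: v_decr)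
  then obtain n where n: "\<And>x. v n x < b" by blast
  \<comment> \<open>With this \<open>B\<close> the window from \<open>n\<close> to
    \<open>n + D n\<close> lies inside the one from \<open>i\<close> to \<open>i + B\<close> for
    every \<open>i \<le> n\<close>. So whichever \<open>g i (D i)\<close> attains
    \<open>v n x\<close>, prolonging it to \<open>g i B\<close> dominates
    \<open>h n x\<close>.\<close>
  define B where "B = n + (\<Sum>i\<le>n. D i)"
  have DB: "D i \<le> B" "n + D n \<le> i + B" if "i \<le> n" for i
    using member_le_sum[of i "{..n}" D] member_le_sum[of n "{..n}" D] that by (auto simp: B_def)
  let ?r = "\<lambda>i x. g i B x - g i (D i) x"
  have r0: "0 \<le> ?r i x" if "i \<le> n" for i x using g_mono[of i i "D i" B x] DB[OF that] by simp
  have "uniformly_small L (\<lambda>x. \<Sum>i\<le>n. ?r i x) (\<Sum>i\<le>n. e * (1/2) ^ (i + 2))"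
    by (rule uniformly_small_sum[OF L]) (use D DB r0 gc in \<open>auto intro!: continuous_intros\<close>)
  then have "uniformly_small L (\<lambda>x. v n x + (\<Sum>i\<le>n. ?r i x)) (C * b + (\<Sum>i\<le>n. e * (1/2) ^ (i + 2)))"
    using n r0 by (intro uniformly_small_add[OF L] uniformly_small_bound[OF L])
      (auto intro!: sum_nonneg vc v0 simp: less_imp_le)
  then have "uniformly_small L (h n) e"
  proof (rule uniformly_small_mono)
    have "(\<Sum>i\<le>n. e * (1/2) ^ (i + 2)) = e * (1/2 - (1/2) ^ (n + 2))"
      by (induction n) (auto simp: algebra_simps)
    also have "\<dots> \<le> e * (1/2)" using \<open>0 < e\<close> by (intro mult_left_mono) auto
    finally show "C * b + (\<Sum>i\<le>n. e * (1/2) ^ (i + 2)) \<le> e" using b by linarith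
    fix x
    obtain i where i: "i \<le> n" "v n x = g i (D i) x" using v_attained by blast
    have "h n x \<le> g n (D n) x" by (rule h_le_g) auto
    also have "\<dots> \<le> g i B x" by (rule g_mono) (use i DB in auto)
    also have "\<dots> = v n x + ?r i x" using i by simp
    also have "?r i x \<le> (\<Sum>i\<le>n. ?r i x)" by (rule member_le_sum) (use i r0 in auto)
    finally show "h n x \<le> v n x + (\<Sum>i\<le>n. ?r i x)" by simp
  qed
  then show ?thesis by blast
qed

section \<open>Weak topologies and the Mackey topology\<close>

lemma topspace_weak_of [simp]: "topspace (weak_of T) = UNIV"
proof -
  have "UNIV = (\<lambda>x. 0 :: real) -` UNIV" by simp
  then have "UNIV \<in> {f -` U | f U. linear f \<and> continuous_map T euclideanreal f \<and> open (U :: real set)}"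
    by (intro CollectI exI[of _ "\<lambda>x. 0"] exI[of _ UNIV]) (auto intro: linear_zero)
  then show ?thesis unfolding weak_of_def topology_generated_by_topspace by blast
qed

lemma continuous_map_from_weak_of:
  assumes "linear g" "continuous_map T euclideanreal g"
  shows "continuous_map (weak_of T) euclideanreal g"
proof -
  have "openin (weak_of T) (g -` U)" if "open U" for U
    unfolding weak_of_def by (rule topology_generated_by_Basis) (use assms that in blast)
  then show ?thesis by (simp add: continuous_map_def vimage_def)
qed

lemma continuous_map_to_weak_of:
  assumes "\<And>g. linear g \<Longrightarrow> continuous_map T euclideanreal g \<Longrightarrow> continuous_map X euclideanreal (\<lambda>x. g (f x))"
  shows "continuous_map X (weak_of T) f"
proof -
  have op: "openin X (f -` U \<inter> topspace X)"
    if "U \<in> {g -` V | g V. linear g \<and> continuous_map T euclideanreal g \<and> open (V :: real set)}" for U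
  proof -
    obtain g V where g: "U = g -` V" "linear g" "continuous_map T euclideanreal g" "open V"
      using \<open>U \<in> _\<close> by blast
    then have "openin X {x \<in> topspace X. g (f x) \<in> V}"
      using assms[of g] by (intro openin_continuous_map_preimage) auto
    moreover have "{x \<in> topspace X. g (f x) \<in> V} = f -` U \<inter> topspace X" using g by auto
    ultimately show ?thesis by simp
  qed
  moreover have "\<Union> {g -` V | g V. linear g \<and> continuous_map T euclideanreal g \<and> open (V :: real set)} = UNIV"
    using topspace_weak_of[of T] unfolding weak_of_def topology_generated_by_topspace .
  ultimately show ?thesis
    unfolding weak_of_def continuous_on_generated_topo_iff by auto
qed

lemma continuous_map_weak_blinfun:
  "continuous_map (weak_of euclidean) euclideanreal (blinfun_apply \<phi>)"
  by (rule continuous_map_from_weak_of)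
    (auto intro: bounded_linear.linear blinfun.bounded_linear_right linear_continuous_on)

lemma limitin_weak_ofI:
  assumes "topspace T = UNIV" "limitin T s l F"
  shows "limitin (weak_of T) s l F"
proof -
  have "continuous_map T (weak_of T) (\<lambda>x. x)" by (rule continuous_map_to_weak_of)
  then show ?thesis using continuous_map_limit[OF _ assms(2)] by (simp add: o_def)
qed

section \<open>Uniform convergence and Mackey neighbourhoods\<close>

lemma limitin_unif_conv_topologyI:
  assumes "\<And>W. W \<in> \<W> \<Longrightarrow> uniform_limit W (\<lambda>i. blinfun_apply (s i)) (blinfun_apply l) F"
  shows "limitin (unif_conv_topology \<W>) s l F"
proof -
  have "filterlim s (unif_conv_nhds \<W> l) F"
    unfolding unif_conv_nhds_def filterlim_filtercomap_iff filterlim_INF o_def using assms by blast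
  then show ?thesis
    unfolding limitin_def openin_unif_conv_topology filterlim_iff by auto
qed

lemma eventually_unif_conv_nhds:
  assumes "W \<in> \<W>" "0 < e"
  shows "\<forall>\<^sub>F \<psi> in unif_conv_nhds \<W> \<phi>. \<forall>x\<in>W. \<bar>blinfun_apply \<psi> x - blinfun_apply \<phi> x\<bar> < e"
proof -
  have "\<forall>\<^sub>F f in (INF W\<in>\<W>. uniformly_on W (blinfun_apply \<phi>)). \<forall>x\<in>W. \<bar>f x - \<phi> x\<bar> < e"
    unfolding uniformly_on_def
    by (rule eventually_INF1[OF assms(1)], rule eventually_INF1[of e]) (use assms(2) in \<open>auto simp: eventually_principal dist_real_def\<close>)
  then show ?thesis unfolding unif_conv_nhds_def by (rule eventually_filtercomapI)
qed

text \<open>The uniform bound \<open>d < e\<close> leaves room for perturbations. Requiring only a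
  value below \<open>e\<close> at each point of an arbitrary \<open>W\<close> need not give an open
  set, since the supremum could equal \<open>e\<close>.\<close>

lemma openin_unif_conv_ball:
  assumes W: "W \<in> \<W>"
  shows "openin (unif_conv_topology \<W>) {\<psi>. \<exists>d<e. \<forall>x\<in>W. \<bar>blinfun_apply \<psi> x - blinfun_apply \<phi> x\<bar> \<le> d}"
  unfolding openin_unif_conv_topology
proof (rule ballI, drule CollectD)
  fix \<psi>\<^sub>0 assume "\<exists>d<e. \<forall>x\<in>W. \<bar>blinfun_apply \<psi>\<^sub>0 x - \<phi> x\<bar> \<le> d"
  then obtain d where d: "d < e" "\<And>x. x \<in> W \<Longrightarrow> \<bar>blinfun_apply \<psi>\<^sub>0 x - \<phi> x\<bar> \<le> d" by blast
  have "\<forall>\<^sub>F \<psi> in unif_conv_nhds \<W> \<psi>\<^sub>0. \<forall>x\<in>W. \<bar>blinfun_apply \<psi> x - \<psi>\<^sub>0 x\<bar> < (e - d) / 2"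
    by (rule eventually_unif_conv_nhds[OF W]) (use d in simp)
  then show "\<forall>\<^sub>F \<psi> in unif_conv_nhds \<W> \<psi>\<^sub>0. \<psi> \<in> {\<psi>. \<exists>d<e. \<forall>x\<in>W. \<bar>blinfun_apply \<psi> x - \<phi> x\<bar> \<le> d}"
  proof eventually_elim
    case (elim \<psi>)
    have "\<bar>blinfun_apply \<psi> x - \<phi> x\<bar> \<le> (e + d) / 2" if "x \<in> W" for x
    proof -
      have "\<bar>blinfun_apply \<psi> x - \<phi> x\<bar> \<le> \<bar>blinfun_apply \<psi> x - \<psi>\<^sub>0 x\<bar> + \<bar>blinfun_apply \<psi>\<^sub>0 x - \<phi> x\<bar>"
        using abs_triangle_ineq[of "blinfun_apply \<psi> x - \<psi>\<^sub>0 x" "blinfun_apply \<psi>\<^sub>0 x - \<phi> x"] by simp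
      also have "\<dots> \<le> (e - d) / 2 + d" using d(2)[OF that] bspec[OF elim that] by linarith
      finally show ?thesis by (simp add: field_simps)
    qed
    then show ?case using d(1) by (intro CollectI exI[of _ "(e + d) / 2"]) simp
  qed
qed

abbreviation mackey_sets :: "'e::real_normed_vector set set" where
  "mackey_sets \<equiv> {W. absolutely_convex W \<and> compactin (weak_of (euclidean :: 'e topology)) W}"

lemma absolutely_convexD:
  "absolutely_convex W \<Longrightarrow> x \<in> W \<Longrightarrow> y \<in> W \<Longrightarrow> \<bar>a\<bar> + \<bar>b\<bar> \<le> 1 \<Longrightarrow> a *\<^sub>R x + b *\<^sub>R y \<in> W"
  by (simp add: absolutely_convex_def)

lemma absolutely_convex_zero: "absolutely_convex W \<Longrightarrow> W \<noteq> {} \<Longrightarrow> 0 \<in> W"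
  using absolutely_convexD[of W _ _ 0 0] by fastforce

lemma absolutely_convex_uminus: "absolutely_convex W \<Longrightarrow> x \<in> W \<Longrightarrow> - x \<in> W"
  using absolutely_convexD[of W x x "-1" 0] by simp

lemma compactin_weak_of_plus:
  fixes A B :: "'e::real_normed_vector set"
  assumes "compactin (weak_of euclidean) A" "compactin (weak_of euclidean) B"
  shows "compactin (weak_of euclidean) {x + y | x y. x \<in> A \<and> y \<in> B}"
proof -
  let ?w = "weak_of (euclidean :: 'e topology)"
  have "continuous_map (prod_topology ?w ?w) ?w (\<lambda>z. fst z + snd z)"
  proof (rule continuous_map_to_weak_of)
    fix g :: "'e \<Rightarrow> real" assume g: "linear g" "continuous_map euclidean euclideanreal g"
    have "continuous_map (prod_topology ?w ?w) euclideanreal (\<lambda>z. g (fst z) + g (snd z))"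
      using continuous_map_compose[OF continuous_map_fst continuous_map_from_weak_of[OF g], of ?w]
        continuous_map_compose[OF continuous_map_snd continuous_map_from_weak_of[OF g], of ?w]
      by (intro continuous_map_add) (auto simp: o_def)
    then show "continuous_map (prod_topology ?w ?w) euclideanreal (\<lambda>z. g (fst z + snd z))"
      using g by (simp add: linear_add)
  qed
  then have "compactin ?w ((\<lambda>z. fst z + snd z) ` (A \<times> B))"
    by (rule image_compactin[rotated]) (simp add: compactin_Times assms)
  moreover have "(\<lambda>z. fst z + snd z) ` (A \<times> B) = {x + y | x y. x \<in> A \<and> y \<in> B}" by force
  ultimately show ?thesis by simp
qed

text \<open>For nonempty sets the sum \<open>A + B\<close> works, because each summand contains 0.
  Directedness lets a single \<open>W\<close> describe a basic Mackey neighbourhood.\<close>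

lemma mackey_sets_directed:
  assumes A: "A \<in> mackey_sets" and B: "B \<in> mackey_sets"
  shows "\<exists>W\<in>mackey_sets. A \<subseteq> W \<and> B \<subseteq> W"
proof (cases "A = {} \<or> B = {}")
  case False
  let ?W = "{x + y | x y. x \<in> A \<and> y \<in> B}"
  have "absolutely_convex ?W"
    unfolding absolutely_convex_def
  proof (intro ballI allI impI)
    fix u v and a b :: real assume "u \<in> ?W" "v \<in> ?W" and ab: "\<bar>a\<bar> + \<bar>b\<bar> \<le> 1"
    then obtain x y x' y' where xy: "u = x + y" "x \<in> A" "y \<in> B" "v = x' + y'" "x' \<in> A" "y' \<in> B" by blast
    have "a *\<^sub>R u + b *\<^sub>R v = (a *\<^sub>R x + b *\<^sub>R x') + (a *\<^sub>R y + b *\<^sub>R y')"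
      by (simp add: xy algebra_simps)
    moreover have "a *\<^sub>R x + b *\<^sub>R x' \<in> A" "a *\<^sub>R y + b *\<^sub>R y' \<in> B"
      using A B xy ab by (auto intro: absolutely_convexD)
    ultimately show "a *\<^sub>R u + b *\<^sub>R v \<in> ?W" by blast
  qed
  moreover have "A \<subseteq> ?W" "B \<subseteq> ?W"
    using absolutely_convex_zero[of A] absolutely_convex_zero[of B] A B False
    by (force intro: exI[of _ 0])+
  ultimately show ?thesis using A B compactin_weak_of_plus by blast
qed (use A B in auto)

text \<open>Segments make Mackey convergence at least as strong as pointwise convergence.\<close>

lemma segment_mackey_set:
  fixes x :: "'e::real_normed_vector"
  shows "(\<lambda>a. a *\<^sub>R x) ` {-1..1} \<in> mackey_sets"
proof -
  have "continuous_map euclideanreal (weak_of (euclidean :: 'e topology)) (\<lambda>a. a *\<^sub>R x)"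
    by (rule continuous_map_to_weak_of)
      (auto simp: linear_scale intro!: continuous_intros)
  then have "compactin (weak_of (euclidean :: 'e topology)) ((\<lambda>a. a *\<^sub>R x) ` {-1..1})"
    by (rule image_compactin[rotated]) simp
  moreover have "absolutely_convex ((\<lambda>a. a *\<^sub>R x) ` {-1..1})"
    unfolding absolutely_convex_def
  proof (intro ballI allI impI)
    fix u v and a b :: real
    assume "u \<in> (\<lambda>a. a *\<^sub>R x) ` {-1..1}" "v \<in> (\<lambda>a. a *\<^sub>R x) ` {-1..1}" and ab: "\<bar>a\<bar> + \<bar>b\<bar> \<le> 1"
    then obtain s t where "u = s *\<^sub>R x" "s \<in> {-1..1}" "v = t *\<^sub>R x" "t \<in> {-1..1}" by blast
    then have st: "u = s *\<^sub>R x" "\<bar>s\<bar> \<le> 1" "v = t *\<^sub>R x" "\<bar>t\<bar> \<le> 1" by auto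
    have "\<bar>a * s + b * t\<bar> \<le> \<bar>a\<bar> * \<bar>s\<bar> + \<bar>b\<bar> * \<bar>t\<bar>" by (metis abs_mult abs_triangle_ineq)
    also have "\<dots> \<le> 1" using st ab mult_left_mono[of "\<bar>s\<bar>" 1 "\<bar>a\<bar>"] mult_left_mono[of "\<bar>t\<bar>" 1 "\<bar>b\<bar>"] by simp
    finally show "a *\<^sub>R u + b *\<^sub>R v \<in> (\<lambda>a. a *\<^sub>R x) ` {-1..1}"
      by (intro image_eqI[of _ _ "a * s + b * t"]) (auto simp: st algebra_simps abs_le_iff)
  qed
  ultimately show ?thesis by simp
qed

lemma mackey_nhds_zero:
  assumes "openin mackey_dual U" "0 \<in> U"
  obtains W e where "W \<in> mackey_sets" "W \<noteq> {}" "0 < e" "\<forall>\<psi>. (\<forall>x\<in>W. \<bar>blinfun_apply \<psi> x\<bar> < e) \<longrightarrow> \<psi> \<in> U"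
proof -
  let ?G = "\<lambda>W::'a set. uniformly_on W (\<lambda>x. 0 :: real)"
  have mono: "?G W \<le> ?G A" if "A \<subseteq> W" for A W
    unfolding uniformly_on_def by (rule INF_mono) (use that in \<open>force simp: le_principal eventually_principal\<close>)
  have "\<forall>\<^sub>F \<psi> in unif_conv_nhds mackey_sets (0 :: 'a \<Rightarrow>\<^sub>L real). \<psi> \<in> U"
    using assms by (simp add: mackey_dual_def openin_unif_conv_topology)
  then obtain Q where Q: "eventually Q (INF W\<in>mackey_sets. ?G W)" "\<And>\<psi>. Q (blinfun_apply \<psi>) \<Longrightarrow> \<psi> \<in> U"
    by (auto simp: unif_conv_nhds_def eventually_filtercomap zero_blinfun.rep_eq)
  have ne: "mackey_sets \<noteq> ({} :: 'a set set)" using segment_mackey_set[of 0] by blast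
  have "\<exists>W\<in>mackey_sets. eventually Q (?G W)"
  proof (subst eventually_INF_base[symmetric, OF ne])
    fix A B :: "'a set" assume "A \<in> mackey_sets" "B \<in> mackey_sets"
    then obtain W where "W \<in> mackey_sets" "A \<subseteq> W" "B \<subseteq> W" using mackey_sets_directed by blast
    then show "\<exists>W\<in>mackey_sets. ?G W \<le> inf (?G A) (?G B)"
      using mono by (intro bexI[of _ W]) auto
  qed (rule Q)
  then obtain W1 where W1: "W1 \<in> mackey_sets" "eventually Q (?G W1)" by blast
  \<comment> \<open>The degenerate segment at 0 is added to make \<open>W\<close> nonempty, so that
    minimisers over \<open>W\<close> exist later.\<close>
  obtain W where W: "W \<in> mackey_sets" "W1 \<subseteq> W" "(\<lambda>a. a *\<^sub>R (0::'a)) ` {-1..1} \<subseteq> W"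
    using mackey_sets_directed[OF W1(1) segment_mackey_set[of 0]] by blast
  have "eventually Q (?G W)" using W1(2) mono[OF W(2)] by (simp add: filter_leD)
  then have "\<exists>e>0. \<forall>f. (\<forall>x\<in>W. \<bar>f x\<bar> < e) \<longrightarrow> Q f"
    unfolding uniformly_on_def
    by (subst (asm) eventually_INF_base)
      (force simp: eventually_principal intro: bexI[where x = "min a b" for a b])+
  then obtain e where "0 < e" "\<And>f. (\<forall>x\<in>W. \<bar>f x\<bar> < e) \<Longrightarrow> Q f" by blast
  moreover have "W \<noteq> {}" using W(3) image_is_empty[of "\<lambda>a. a *\<^sub>R (0::'a)" "{-1..1}"] by auto
  ultimately show ?thesis using that[of W e] W(1) Q(2) by blast
qed

text \<open>Mackey--Arens. Hahn--Banach is avoided: on finitely many \<open>\<psi>\<close> the functional \<open>G\<close> is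
  interpolated by a least-squares minimiser over a weakly compact set, and compactness then
  deals with all \<open>\<psi>\<close> at once.\<close>

lemma mackey_dual_functional:
  fixes G :: "('e::real_normed_vector \<Rightarrow>\<^sub>L real) \<Rightarrow> real"
  assumes G: "linear G" "continuous_map mackey_dual euclideanreal G"
  shows "\<exists>x. \<forall>\<psi>. G \<psi> = blinfun_apply \<psi> x"
proof -
  let ?w = "weak_of (euclidean :: 'e topology)"
  have "openin mackey_dual {\<psi> \<in> topspace mackey_dual. G \<psi> \<in> {-1<..<1}}"
    by (rule openin_continuous_map_preimage[OF G(2)]) simp
  moreover have "topspace (mackey_dual :: ('e \<Rightarrow>\<^sub>L real) topology) = UNIV" by (simp add: mackey_dual_def)
  ultimately have "openin mackey_dual {\<psi>. \<bar>G \<psi>\<bar> < 1}" by (simp add: abs_less_iff minus_less_iff conj_commute)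
  moreover have "0 \<in> {\<psi>. \<bar>G \<psi>\<bar> < 1}" by (simp add: linear_0[OF G(1)])
  ultimately obtain W e where W: "W \<in> mackey_sets" "W \<noteq> {}" and e: "0 < e"
    and We: "\<forall>\<psi>. (\<forall>x\<in>W. \<bar>blinfun_apply \<psi> x\<bar> < e) \<longrightarrow> \<psi> \<in> {\<psi>. \<bar>G \<psi>\<bar> < 1}"
    by (rule mackey_nhds_zero)
  have ac: "absolutely_convex W" and cpt: "compactin ?w W" using W by auto
  define c where "c = 2 / e"
  have c: "0 < c" using e by (simp add: c_def)
  \<comment> \<open>Rescaling \<open>\<psi>\<close> to size at most \<open>e / 2\<close> on
    \<open>W\<close> shows that \<open>G\<close> is bounded by \<open>c\<close> times the supremum
    over \<open>W\<close>. This suggests looking for the representing point in the multiple of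
    \<open>W\<close> by \<open>c\<close>.\<close>
  have Gbound: "\<bar>G \<psi>\<bar> \<le> c * t" if "0 < t" "\<And>x. x \<in> W \<Longrightarrow> \<bar>blinfun_apply \<psi> x\<bar> \<le> t" for \<psi> t
  proof -
    let ?r = "e / (2 * t)"
    have "\<bar>blinfun_apply (?r *\<^sub>R \<psi>) x\<bar> < e" if "x \<in> W" for x
    proof -
      have "\<bar>blinfun_apply (?r *\<^sub>R \<psi>) x\<bar> = ?r * \<bar>blinfun_apply \<psi> x\<bar>"
        using e \<open>0 < t\<close> by (simp add: blinfun.scaleR_left abs_mult)
      also have "\<dots> \<le> ?r * t" using that \<open>\<And>x. x \<in> W \<Longrightarrow> _\<close> e \<open>0 < t\<close> by (intro mult_left_mono) auto
      also have "\<dots> < e" using e \<open>0 < t\<close> by simp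
      finally show ?thesis .
    qed
    then have "\<bar>G (?r *\<^sub>R \<psi>)\<bar> < 1" using We by blast
    then have "?r * \<bar>G \<psi>\<bar> < 1" using e \<open>0 < t\<close> by (simp add: linear_scale[OF G(1)] abs_mult)
    then show ?thesis using e \<open>0 < t\<close> by (simp add: c_def field_simps)
  qed
  have interp: "\<exists>w\<in>W. \<forall>\<psi>\<in>I. c * blinfun_apply \<psi> w = G \<psi>" if I: "finite I" for I
  proof -
    \<comment> \<open>The squared error of representing \<open>G\<close> on \<open>I\<close> by
      \<open>c *\<^sub>R w\<close>; it is weakly continuous, so it attains its minimum on
      \<open>W\<close>.\<close>
    define Q where "Q w = (\<Sum>\<psi>\<in>I. (c * blinfun_apply \<psi> w - G \<psi>)\<^sup>2)" for w
    have "continuous_map ?w euclideanreal Q"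
      unfolding Q_def using I
      by (intro continuous_map_sum continuous_map_real_pow continuous_map_diff continuous_map_real_mult)
        (auto intro: continuous_map_weak_blinfun)
    then have "compact (Q ` W)" using image_compactin[OF cpt] by fastforce
    then obtain w0 where w0: "w0 \<in> W" "\<And>w. w \<in> W \<Longrightarrow> Q w0 \<le> Q w"
      using compact_attains_inf[of "Q ` W"] W(2) by auto
    \<comment> \<open>\<open>d\<close> is the residual at the minimiser and \<open>v\<close>
      combines the functionals with these weights. First-order optimality says that \<open>v\<close>
      is largest over \<open>W\<close> at \<open>w0\<close>, and by symmetry of \<open>W\<close>
      this bounds \<open>\<bar>v\<bar>\<close> on \<open>W\<close>.\<close>
    define d where "d \<psi> = G \<psi> - c * blinfun_apply \<psi> w0" for \<psi>
    define v where "v = (\<Sum>\<psi>\<in>I. d \<psi> *\<^sub>R \<psi>)"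
    have v: "blinfun_apply v x = (\<Sum>\<psi>\<in>I. d \<psi> * blinfun_apply \<psi> x)" for x
      by (simp add: v_def blinfun.sum_left blinfun.scaleR_left)
    have max: "blinfun_apply v w \<le> blinfun_apply v w0" if w: "w \<in> W" for w
    proof (rule ccontr)
      assume "\<not> ?thesis"
      then have pos: "0 < blinfun_apply v (w - w0)" by (simp add: blinfun.diff_right)
      define R where "R = (\<Sum>\<psi>\<in>I. (c * blinfun_apply \<psi> (w - w0))\<^sup>2)"
      have R0: "0 \<le> R" unfolding R_def by (intro sum_nonneg) simp
      define a where "a = c * blinfun_apply v (w - w0)"
      have a: "0 < a" using pos c by (simp add: a_def)
      \<comment> \<open>Moving from \<open>w0\<close> towards \<open>w\<close> by \<open>s\<close>
        changes \<open>Q\<close> by \<open>- s * (2 * a - s * R)\<close>; this choice keeps the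
        bracket positive without leaving the segment.\<close>
      define s where "s = min 1 (a / (R + 1))"
      have s: "0 < s" "s \<le> 1" "s * R < 2 * a"
      proof -
        show "0 < s" "s \<le> 1" using a R0 by (auto simp: s_def)
        have "s * R \<le> a / (R + 1) * R" using R0 by (intro mult_right_mono) (auto simp: s_def)
        also have "\<dots> \<le> a" using R0 a by (simp add: field_simps)
        also have "\<dots> < 2 * a" using a by simp
        finally show "s * R < 2 * a" .
      qed
      let ?w = "(1 - s) *\<^sub>R w0 + s *\<^sub>R w"
      have "(c * blinfun_apply \<psi> ?w - G \<psi>)\<^sup>2 =
          (c * blinfun_apply \<psi> w0 - G \<psi>)\<^sup>2 - 2 * s * c * (d \<psi> * blinfun_apply \<psi> (w - w0))
          + s\<^sup>2 * (c * blinfun_apply \<psi> (w - w0))\<^sup>2" for \<psi>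
        by (simp add: d_def blinfun.add_right blinfun.diff_right blinfun.scaleR_right power2_eq_square algebra_simps)
      then have "Q ?w = Q w0 - 2 * s * c * blinfun_apply v (w - w0) + s\<^sup>2 * R"
        by (simp add: Q_def R_def v sum.distrib sum_subtractf sum_distrib_left)
      also have "\<dots> = Q w0 - s * (2 * a - s * R)" by (simp add: a_def power2_eq_square algebra_simps)
      also have "\<dots> < Q w0" using s by simp
      finally have "Q ?w < Q w0" .
      moreover have "?w \<in> W" using s by (intro absolutely_convexD[OF ac w0(1) w]) auto
      ultimately show False using w0(2) by fastforce
    qed
    have Wb: "\<bar>blinfun_apply v w\<bar> \<le> blinfun_apply v w0" if "w \<in> W" for w
      using max[OF that] max[OF absolutely_convex_uminus[OF ac that]] by (simp add: blinfun.minus_right)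
    have b0: "0 \<le> blinfun_apply v w0" using Wb[OF w0(1)] by linarith
    have "G v = (\<Sum>\<psi>\<in>I. d \<psi> * G \<psi>)"
      by (simp add: v_def linear_sum[OF G(1)] linear_scale[OF G(1)])
    moreover have "c * blinfun_apply v w0 = (\<Sum>\<psi>\<in>I. d \<psi> * (c * blinfun_apply \<psi> w0))"
      by (simp add: v sum_distrib_left algebra_simps)
    ultimately have "G v - c * blinfun_apply v w0 = (\<Sum>\<psi>\<in>I. d \<psi> * (G \<psi> - c * blinfun_apply \<psi> w0))"
      by (simp add: sum_subtractf algebra_simps)
    also have "\<dots> = Q w0" unfolding Q_def d_def by (simp add: power2_eq_square algebra_simps)
    finally have GQ: "G v = c * blinfun_apply v w0 + Q w0" by simp
    have Q0: "0 \<le> Q w0" unfolding Q_def by (intro sum_nonneg) simp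
    have "Q w0 = 0"
    proof (rule ccontr)
      assume "Q w0 \<noteq> 0"
      then have q: "0 < Q w0" using Q0 by simp
      \<comment> \<open>\<open>Gbound\<close> needs a positive bound, while \<open>v\<close> may
        vanish at \<open>w0\<close>. The slack costs only half of \<open>Q w0\<close>, which still
        contradicts \<open>GQ\<close>.\<close>
      let ?t = "blinfun_apply v w0 + Q w0 / (2 * c)"
      have t: "blinfun_apply v w0 \<le> ?t" "0 < ?t" using q c b0 by (auto intro: add_nonneg_pos)
      have "\<bar>G v\<bar> \<le> c * ?t" by (rule Gbound[OF t(2) order_trans[OF Wb t(1)]])
      moreover have "c * ?t = c * blinfun_apply v w0 + Q w0 / 2" using c by (simp add: field_simps)
      ultimately show False using GQ q by linarith
    qed
    then show ?thesis using w0(1) I by (auto simp: Q_def sum_nonneg_eq_0_iff intro!: bexI[of _ w0])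
  qed
  let ?S = "\<lambda>\<psi>. {w \<in> topspace ?w. blinfun_apply \<psi> w \<in> {G \<psi> / c}}"
  have S_eq: "w \<in> ?S \<psi> \<longleftrightarrow> c * blinfun_apply \<psi> w = G \<psi>" for w \<psi> using c by (auto simp: field_simps)
  have closed: "\<forall>C\<in>range ?S. closedin ?w C"
  proof
    fix C assume "C \<in> range ?S"
    then obtain \<psi> where "C = ?S \<psi>" by blast
    moreover have "closedin ?w (?S \<psi>)"
      by (rule closedin_continuous_map_preimage[OF continuous_map_weak_blinfun]) simp
    ultimately show "closedin ?w C" by simp
  qed
  have "W \<inter> \<Inter>\<F> \<noteq> {}" if \<F>: "finite \<F>" "\<F> \<subseteq> range ?S" for \<F>
  proof -
    obtain I where I: "finite I" "\<F> = ?S ` I" using finite_subset_image[OF \<F>] by blast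
    obtain w where "w \<in> W" "\<forall>\<psi>\<in>I. c * blinfun_apply \<psi> w = G \<psi>" using interp[OF I(1)] by blast
    then have "w \<in> W \<inter> \<Inter>\<F>" unfolding I(2) using S_eq by blast
    then show ?thesis by blast
  qed
  then have "W \<inter> \<Inter>(range ?S) \<noteq> {}" using cpt closed unfolding compactin_fip by blast
  then obtain w where "\<And>\<psi>. w \<in> ?S \<psi>" by blast
  then have "c * blinfun_apply \<psi> w = G \<psi>" for \<psi> using S_eq by blast
  then have "\<forall>\<psi>. G \<psi> = blinfun_apply \<psi> (c *\<^sub>R w)" by (simp add: blinfun.scaleR_right)
  then show ?thesis by blast
qed

section \<open>Completeness of the Mackey dual\<close>

text \<open>By Baire, some closed set \<open>A n\<close> contains a ball, and differences of points
  of that ball control all \<open>T i\<close> near 0. Completeness is a hypothesis on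
  \<open>UNIV\<close>, so that bounded continuous functions on any topological space qualify through
  \<open>complete_UNIV_bcontfun\<close>.\<close>

lemma uniform_boundedness:
  fixes T :: "'i \<Rightarrow> 'a::real_normed_vector \<Rightarrow> 'b::real_normed_vector"
  assumes compl: "complete (UNIV :: 'a set)" and T: "\<And>i. i \<in> I \<Longrightarrow> bounded_linear (T i)"
    and bd: "\<And>x. \<exists>c. \<forall>i\<in>I. norm (T i x) \<le> c"
  shows "\<exists>C. \<forall>i\<in>I. \<forall>x. norm (T i x) \<le> C * norm x"
proof -
  define A where "A n = (\<Inter>i\<in>I. {x. norm (T i x) \<le> real n})" for n
  have clA: "closed (A n)" for n
    unfolding A_def
  proof (intro closed_INT ballI)
    fix i assume "i \<in> I"
    then show "closed {x. norm (T i x) \<le> real n}"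
      by (intro closed_Collect_le continuous_intros linear_continuous_on T)
  qed
  have cover: "(\<Union>n. A n) = UNIV"
  proof (intro set_eqI iffI UNIV_I)
    fix x
    obtain c where c: "\<forall>i\<in>I. norm (T i x) \<le> c" using bd by blast
    obtain n where "c \<le> real n" using real_arch_simple by blast
    then have "x \<in> A n" using c by (auto simp: A_def intro: order_trans)
    then show "x \<in> (\<Union>n. A n)" by blast
  qed
  have "completely_metrizable_space (euclidean :: 'a topology)"
    using Met_TC.completely_metrizable_space_mtopology compl by auto
  then have "\<exists>n. interior (A n) \<noteq> {}"
    using Baire_category_alt[of "euclidean :: 'a topology" "range A"] clA cover by auto
  then obtain n x0 where "x0 \<in> interior (A n)" by blast
  then obtain r where r: "0 < r" "cball x0 r \<subseteq> A n" by (auto simp: mem_interior_cball)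
  have "norm (T i x) \<le> (2 * real n / r) * norm x" if i: "i \<in> I" for i x
  proof (cases "x = 0")
    case True
    then show ?thesis using T[OF i] by (simp add: linear_simps)
  next
    case False
    interpret bounded_linear "T i" by (rule T[OF i])
    let ?y = "(r / norm x) *\<^sub>R x"
    have "x0 + ?y \<in> cball x0 r" "x0 \<in> cball x0 r" using r False by (simp_all add: dist_norm)
    then have "x0 + ?y \<in> A n" "x0 \<in> A n" using r(2) by blast+
    then have "norm (T i (x0 + ?y)) \<le> n" "norm (T i x0) \<le> n" using i by (simp_all add: A_def)
    moreover have "T i ?y = T i (x0 + ?y) - T i x0" by (simp add: add)
    ultimately have "norm (T i ?y) \<le> 2 * n"
      using norm_triangle_ineq4[of "T i (x0 + ?y)" "T i x0"] by simp
    then show ?thesis using r False by (simp add: scaleR field_simps)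
  qed
  then show ?thesis by blast
qed

lemma complete_UNIV_bcontfun:
  "complete (UNIV :: ('a::topological_space \<Rightarrow>\<^sub>C 'b::complete_space) set)"
  unfolding complete_def
proof (intro allI impI)
  fix f :: "nat \<Rightarrow> 'a \<Rightarrow>\<^sub>C 'b" assume "(\<forall>n. f n \<in> UNIV) \<and> Cauchy f"
  then obtain g where "uniform_limit UNIV f g sequentially"
    using uniformly_convergent_eq_cauchy[of "\<lambda>_. True" f]
    unfolding Cauchy_def uniform_limit_sequentially_iff
    by (metis dist_fun_lt_imp_dist_val_lt)
  then obtain l where "f \<longlonglongrightarrow> l" by (rule uniform_limit_bcontfunE) simp
  then show "\<exists>l\<in>UNIV. f \<longlonglongrightarrow> l" by blast
qed

lemma abs_summable_sums:
  fixes f :: "nat \<Rightarrow> 'a::real_normed_vector"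
  assumes compl: "complete (UNIV :: 'a set)" and s: "summable (\<lambda>n. norm (f n))"
  shows "f sums suminf f"
proof -
  let ?N = "\<lambda>n. \<Sum>i<n. norm (f i)"
  have le: "norm (sum f {..<n} - sum f {..<m}) \<le> \<bar>?N n - ?N m\<bar>" for m n
  proof (induction m n rule: linorder_wlog)
    case (le m n)
    have "norm (sum f {..<n} - sum f {..<m}) = norm (sum f {m..<n})"
      using sum_diff_nat_ivl[of 0 m n f] le by (simp add: atLeast0LessThan)
    also have "\<dots> \<le> (\<Sum>i=m..<n. norm (f i))" by (rule norm_sum)
    also have "\<dots> = ?N n - ?N m"
      using sum_diff_nat_ivl[of 0 m n "\<lambda>i. norm (f i)"] le by (simp add: atLeast0LessThan)
    finally show ?case by simp
  next
    case (sym m n)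
    then show ?case by (simp add: norm_minus_commute abs_minus_commute)
  qed
  have "Cauchy ?N" using s by (simp add: summable_iff_convergent convergent_Cauchy)
  then have "Cauchy (\<lambda>n. sum f {..<n})"
    unfolding Cauchy_def dist_norm real_norm_def using le by (meson le_less_trans)
  then obtain l where "(\<lambda>n. sum f {..<n}) \<longlonglongrightarrow> l" using compl unfolding complete_def by blast
  then have "f sums l" by (simp add: sums_def)
  then show ?thesis by (rule summable_sums[OF sums_summable])
qed

lemma bounded_linear_if_continuous:
  fixes g :: "'a::real_normed_vector \<Rightarrow> 'b::real_normed_vector"
  assumes "linear g" "continuous_on UNIV g"
  shows "bounded_linear g"
proof -
  have "isCont g 0" using assms(2) by (simp add: continuous_on_eq_continuous_at)
  then obtain d where d: "0 < d" "\<forall>x. norm x < d \<longrightarrow> norm (g x) < 1"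
    unfolding continuous_at_eps_delta linear_0[OF assms(1)] dist_norm diff_0_right by (metis zero_less_one)
  define r where "r = d / 2"
  have r: "0 < r" "\<And>x. norm x \<le> r \<Longrightarrow> norm (g x) \<le> 1" using d by (auto simp: r_def intro!: less_imp_le)
  have "norm (g x) \<le> norm x * (1 / r)" for x
  proof (cases "x = 0")
    case False
    have "norm (g ((r / norm x) *\<^sub>R x)) \<le> 1" by (rule r(2)) (use r(1) False in simp)
    then show ?thesis using r(1) False by (simp add: linear_scale[OF assms(1)] field_simps)
  qed (simp add: linear_0[OF assms(1)])
  then show ?thesis
    by (intro bounded_linear_intro[of g "1 / r"]) (simp_all add: linear_add linear_scale assms(1))
qed

section \<open>Weakly compact hulls of weakly null sequences\<close>

text \<open>The closed unit ball of l1, taken as a set of plain sequences so that it carries the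
  topology of coordinatewise convergence, in which it is compact.\<close>

definition l1_ball :: "(nat \<Rightarrow> real) set" where
  "l1_ball = {a. \<forall>n. (\<Sum>i<n. \<bar>a i\<bar>) \<le> 1}"

lemma compact_l1_ball: "compact l1_ball"
proof -
  have "compactin (product_topology (\<lambda>i::nat. euclideanreal) UNIV) (PiE UNIV (\<lambda>i. {-1..1}))"
    unfolding compactin_PiE by simp
  then have "compact (PiE UNIV (\<lambda>i::nat. {-1..1::real}))" by (simp add: euclidean_product_topology)
  moreover have "closed l1_ball"
    unfolding l1_ball_def by (intro closed_Collect_all closed_Collect_le continuous_intros) auto
  moreover have "l1_ball \<subseteq> PiE UNIV (\<lambda>i. {-1..1})"
  proof
    fix a :: "nat \<Rightarrow> real" assume "a \<in> l1_ball"
    then have "(\<Sum>j<Suc i. \<bar>a j\<bar>) \<le> 1" for i by (simp only: l1_ball_def mem_Collect_eq)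
    then have "\<bar>a i\<bar> \<le> 1" for i
      using member_le_sum[of i "{..<Suc i}" "\<lambda>j. \<bar>a j\<bar>"] by (meson abs_ge_zero finite_lessThan lessI lessThan_iff order_trans)
    then show "a \<in> PiE UNIV (\<lambda>i. {-1..1})" by (simp add: abs_le_iff PiE_UNIV_domain minus_le_iff)
  qed
  ultimately show ?thesis by (metis compact_Int_closed inf.absorb_iff2)
qed

lemma l1_ballD:
  assumes "a \<in> l1_ball" "finite I"
  shows "(\<Sum>i\<in>I. \<bar>a i\<bar>) \<le> 1"
proof -
  obtain n where "I \<subseteq> {..<n}" using assms(2) finite_nat_iff_bounded by blast
  then have "(\<Sum>i\<in>I. \<bar>a i\<bar>) \<le> (\<Sum>i<n. \<bar>a i\<bar>)" by (intro sum_mono2) auto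
  then show ?thesis using assms(1) order_trans by (auto simp: l1_ball_def)
qed

text \<open>The set \<open>W\<close> is the image of the l1 ball under \<open>S\<close>, which sends
  \<open>a\<close> to the sum of the \<open>a n *\<^sub>R x n\<close>. Weak nullness of
  \<open>x\<close> makes \<open>S\<close> continuous from the coordinatewise to the weak topology,
  so compactness of the ball carries over.\<close>

lemma weakly_null_hull:
  fixes x :: "nat \<Rightarrow> 'e::real_normed_vector"
  assumes compl: "complete (UNIV :: 'e set)" and B: "\<And>n. norm (x n) \<le> B"
    and null: "\<And>\<phi> :: 'e \<Rightarrow>\<^sub>L real. (\<lambda>n. blinfun_apply \<phi> (x n)) \<longlonglongrightarrow> 0"
  shows "\<exists>W\<in>mackey_sets. range x \<subseteq> W"
proof -
  define S where "S a = (\<Sum>n. a n *\<^sub>R x n)" for a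
  have S: "(\<lambda>n. a n *\<^sub>R x n) sums S a" if a: "a \<in> l1_ball" for a
    unfolding S_def
  proof (rule abs_summable_sums[OF compl])
    have B0: "0 \<le> B" using B[of 0] norm_ge_zero order_trans by blast
    show "summable (\<lambda>n. norm (a n *\<^sub>R x n))"
    proof (rule bounded_imp_summable)
      fix n
      have "(\<Sum>i\<le>n. norm (a i *\<^sub>R x i)) \<le> (\<Sum>i\<le>n. \<bar>a i\<bar> * B)"
        by (intro sum_mono) (simp add: mult_left_mono B)
      also have "\<dots> \<le> 1 * B"
        unfolding sum_distrib_right[symmetric] by (intro mult_right_mono l1_ballD a B0) simp
      finally show "(\<Sum>i\<le>n. norm (a i *\<^sub>R x i)) \<le> B" by simp
    qed simp
  qed
  have "continuous_map (top_of_set l1_ball) (weak_of (euclidean :: 'e topology)) S"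
  proof (rule continuous_map_to_weak_of)
    fix g :: "'e \<Rightarrow> real" assume g: "linear g" "continuous_map euclidean euclideanreal g"
    then have "bounded_linear g" by (simp add: bounded_linear_if_continuous)
    then obtain \<phi> where g_eq: "g = blinfun_apply \<phi>" using bounded_linear_Blinfun_apply by metis
    have sums: "(\<lambda>n. a n * g (x n)) sums g (S a)" if "a \<in> l1_ball" for a
      using bounded_linear.sums[OF \<open>bounded_linear g\<close> S[OF that]] by (simp add: linear_scale[OF g(1)])
    \<comment> \<open>As the coefficients have l1 norm at most 1, a tail is bounded by the supremum
      of the remaining \<open>\<bar>g (x i)\<bar>\<close>, whatever \<open>a\<close> is.\<close>
    have "uniform_limit l1_ball (\<lambda>n a. \<Sum>i<n. a i * g (x i)) (\<lambda>a. g (S a)) sequentially"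
    proof (rule uniform_limitI)
      fix e :: real assume "0 < e"
      then obtain N where N: "\<And>n. N \<le> n \<Longrightarrow> \<bar>g (x n)\<bar> < e / 2"
        using tendstoD[OF null[of \<phi>], of "e / 2"] by (auto simp: g_eq eventually_sequentially)
      have "dist (\<Sum>i<n. a i * g (x i)) (g (S a)) < e" if n: "N \<le> n" and a: "a \<in> l1_ball" for n a
      proof -
        have "\<bar>(\<Sum>i<m. a i * g (x i)) - (\<Sum>i<n. a i * g (x i))\<bar> \<le> e / 2" if "n \<le> m" for m
        proof -
          have "(\<Sum>i<m. a i * g (x i)) - (\<Sum>i<n. a i * g (x i)) = (\<Sum>i=n..<m. a i * g (x i))"
            using sum_diff_nat_ivl[of 0 n m "\<lambda>i. a i * g (x i)"] that by (simp add: atLeast0LessThan)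
          also have "\<bar>\<dots>\<bar> \<le> (\<Sum>i=n..<m. \<bar>a i * g (x i)\<bar>)" by (rule sum_abs)
          also have "\<dots> \<le> (\<Sum>i=n..<m. \<bar>a i\<bar> * (e / 2))"
          proof (rule sum_mono)
            fix i assume "i \<in> {n..<m}"
            then have "\<bar>g (x i)\<bar> \<le> e / 2" using N n by (auto intro: less_imp_le)
            then show "\<bar>a i * g (x i)\<bar> \<le> \<bar>a i\<bar> * (e / 2)" unfolding abs_mult by (rule mult_left_mono) simp
          qed
          also have "\<dots> \<le> 1 * (e / 2)"
            unfolding sum_distrib_right[symmetric] using \<open>0 < e\<close> by (intro mult_right_mono l1_ballD a) auto
          finally show ?thesis by simp
        qed
        moreover have "(\<lambda>m. \<bar>(\<Sum>i<m. a i * g (x i)) - (\<Sum>i<n. a i * g (x i))\<bar>) \<longlonglongrightarrow> \<bar>g (S a) - (\<Sum>i<n. a i * g (x i))\<bar>"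
          using sums[OF a] unfolding sums_def by (intro tendsto_intros)
        ultimately have "\<bar>g (S a) - (\<Sum>i<n. a i * g (x i))\<bar> \<le> e / 2"
          using LIMSEQ_le_const2 by blast
        then show ?thesis using \<open>0 < e\<close> by (simp add: dist_real_def abs_minus_commute)
      qed
      then show "\<forall>\<^sub>F n in sequentially. \<forall>a\<in>l1_ball. dist (\<Sum>i<n. a i * g (x i)) (g (S a)) < e"
        by (auto simp: eventually_sequentially)
    qed
    then have "continuous_on l1_ball (\<lambda>a. g (S a))"
    proof (rule uniform_limit_theorem[rotated])
      have "continuous_on l1_ball (\<lambda>a::nat \<Rightarrow> real. a i)" for i
        by (rule continuous_on_subset[OF continuous_on_product_coordinates]) simp
      then show "\<forall>\<^sub>F n in sequentially. continuous_on l1_ball (\<lambda>a. \<Sum>i<n. a i * g (x i))"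
        by (intro always_eventually allI continuous_intros)
    qed simp
    then show "continuous_map (top_of_set l1_ball) euclideanreal (\<lambda>a. g (S a))" by simp
  qed
  then have "compactin (weak_of euclidean) (S ` l1_ball)"
    by (rule image_compactin[rotated]) (simp add: compact_l1_ball)
  moreover have "absolutely_convex (S ` l1_ball)"
    unfolding absolutely_convex_def
  proof (intro ballI allI impI)
    fix u v and s t :: real assume "u \<in> S ` l1_ball" "v \<in> S ` l1_ball" and st: "\<bar>s\<bar> + \<bar>t\<bar> \<le> 1"
    then obtain a b where ab: "u = S a" "a \<in> l1_ball" "v = S b" "b \<in> l1_ball" by blast
    let ?c = "\<lambda>n. s * a n + t * b n"
    have c: "?c \<in> l1_ball"
      unfolding l1_ball_def
    proof (intro CollectI allI)
      fix n
      have "(\<Sum>i<n. \<bar>?c i\<bar>) \<le> (\<Sum>i<n. \<bar>s\<bar> * \<bar>a i\<bar> + \<bar>t\<bar> * \<bar>b i\<bar>)"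
        by (intro sum_mono) (metis abs_mult abs_triangle_ineq)
      also have "\<dots> = \<bar>s\<bar> * (\<Sum>i<n. \<bar>a i\<bar>) + \<bar>t\<bar> * (\<Sum>i<n. \<bar>b i\<bar>)"
        by (simp add: sum.distrib sum_distrib_left)
      also have "\<dots> \<le> \<bar>s\<bar> * 1 + \<bar>t\<bar> * 1"
        by (intro add_mono mult_left_mono l1_ballD ab) auto
      finally show "(\<Sum>i<n. \<bar>?c i\<bar>) \<le> 1" using st by simp
    qed
    have "(\<lambda>n. ?c n *\<^sub>R x n) sums (s *\<^sub>R S a + t *\<^sub>R S b)"
      using sums_add[OF sums_scaleR_right[OF S[OF ab(2)], of s] sums_scaleR_right[OF S[OF ab(4)], of t]]
      by (simp add: algebra_simps)
    then have "s *\<^sub>R u + t *\<^sub>R v = S ?c" using sums_unique2[OF S[OF c]] ab by simp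
    then show "s *\<^sub>R u + t *\<^sub>R v \<in> S ` l1_ball" using c by blast
  qed
  moreover have "x n \<in> S ` l1_ball" for n
  proof -
    let ?a = "\<lambda>i. if i = n then 1 else 0 :: real"
    have a: "?a \<in> l1_ball"
      unfolding l1_ball_def by (auto simp: if_distrib[of abs] sum.delta cong: if_cong)
    have "(\<lambda>i. ?a i *\<^sub>R x i) = (\<lambda>i. if i = n then x i else 0)" by auto
    then have "(\<lambda>i. ?a i *\<^sub>R x i) sums x n" using sums_single[of n x] by simp
    then have "S ?a = x n" by (rule sums_unique2[OF S[OF a]])
    with a show ?thesis by (metis imageI)
  qed
  ultimately show ?thesis by blast
qed

section \<open>Limits of Mackey-Cauchy filters\<close>

lemma cauchy_filter_mackeyD:
  assumes "cauchy_filter_in mackey_dual F" "W \<in> mackey_sets" "0 < e"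
  shows "\<exists>A. (\<forall>\<^sub>F \<psi> in F. \<psi> \<in> A) \<and>
    (\<forall>\<psi>\<in>A. \<forall>\<psi>'\<in>A. \<forall>x\<in>W. \<bar>blinfun_apply \<psi> x - blinfun_apply \<psi>' x\<bar> < e)"
proof -
  let ?U = "{\<psi>. \<exists>d<e. \<forall>x\<in>W. \<bar>blinfun_apply \<psi> x - blinfun_apply 0 x\<bar> \<le> d}"
  have "openin mackey_dual ?U"
    unfolding mackey_dual_def by (rule openin_unif_conv_ball[OF assms(2)])
  moreover have "0 \<in> ?U" using assms(3) by (auto intro!: exI[of _ 0])
  ultimately obtain A where A: "\<forall>\<^sub>F \<psi> in F. \<psi> \<in> A" "\<forall>\<psi>\<in>A. \<forall>\<psi>'\<in>A. \<psi> - \<psi>' \<in> ?U"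
    using assms(1) unfolding cauchy_filter_in_def by blast
  show ?thesis
  proof (intro exI[of _ A] conjI ballI A(1))
    fix \<psi> \<psi>' x assume "\<psi> \<in> A" "\<psi>' \<in> A" "x \<in> W"
    then have "\<exists>d<e. \<bar>blinfun_apply (\<psi> - \<psi>') x - blinfun_apply 0 x\<bar> \<le> d" using A(2) by blast
    then show "\<bar>blinfun_apply \<psi> x - blinfun_apply \<psi>' x\<bar> < e" by (auto simp: blinfun.diff_left)
  qed
qed

lemma complete_mackey_dual:
  assumes compl: "complete (UNIV :: 'e::real_normed_vector set)"
  shows "complete_lcs (mackey_dual :: ('e \<Rightarrow>\<^sub>L real) topology)"
  unfolding complete_lcs_def
proof (intro allI impI)
  fix F :: "('e \<Rightarrow>\<^sub>L real) filter" assume F: "cauchy_filter_in mackey_dual F"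
  have ne: "F \<noteq> bot" using F by (simp add: cauchy_filter_in_def)
  have "\<exists>l. ((\<lambda>\<psi>. blinfun_apply \<psi> x) \<longlongrightarrow> l) F" for x
  proof -
    have "cauchy_filter (filtermap (\<lambda>\<psi>. blinfun_apply \<psi> x) F)"
      unfolding cauchy_filter_metric_filtermap
    proof (intro allI impI)
      fix e :: real assume "0 < e"
      then obtain A where A: "\<forall>\<^sub>F \<psi> in F. \<psi> \<in> A"
        "\<forall>\<psi>\<in>A. \<forall>\<psi>'\<in>A. \<forall>y\<in>(\<lambda>a. a *\<^sub>R x) ` {-1..1}. \<bar>blinfun_apply \<psi> y - blinfun_apply \<psi>' y\<bar> < e"
        using cauchy_filter_mackeyD[OF F segment_mackey_set] by blast
      have "x \<in> (\<lambda>a. a *\<^sub>R x) ` {-1..1}" by (rule image_eqI[of _ _ 1]) auto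
      then have "\<forall>\<psi>\<in>A. \<forall>\<psi>'\<in>A. \<bar>blinfun_apply \<psi> x - blinfun_apply \<psi>' x\<bar> < e" using A(2) by blast
      then show "\<exists>P. eventually P F \<and> (\<forall>\<psi> \<psi>'. P \<psi> \<and> P \<psi>' \<longrightarrow> dist (blinfun_apply \<psi> x) (blinfun_apply \<psi>' x) < e)"
        using A(1) by (intro exI[of _ "\<lambda>\<psi>. \<psi> \<in> A"]) (simp add: dist_real_def)
    qed
    then have "\<exists>l. filtermap (\<lambda>\<psi>. blinfun_apply \<psi> x) F \<le> nhds l"
      using cauchy_filter_complete_converges[OF _ complete_UNIV, of "filtermap (\<lambda>\<psi>. blinfun_apply \<psi> x) F"] ne
      by (simp add: filtermap_bot_iff)
    then show ?thesis by (auto simp: filterlim_def)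
  qed
  then obtain f where f: "\<And>x. ((\<lambda>\<psi>. blinfun_apply \<psi> x) \<longlongrightarrow> f x) F" by metis
  have lin: "linear f"
  proof (rule linearI)
    fix x y and r :: real
    have "((\<lambda>\<psi>. blinfun_apply \<psi> (x + y)) \<longlongrightarrow> f x + f y) F"
      unfolding blinfun.add_right by (intro tendsto_intros f)
    then show "f (x + y) = f x + f y" using tendsto_unique[OF ne f] by blast
    have "((\<lambda>\<psi>. blinfun_apply \<psi> (r *\<^sub>R x)) \<longlongrightarrow> r *\<^sub>R f x) F"
      unfolding blinfun.scaleR_right by (intro tendsto_intros f)
    then show "f (r *\<^sub>R x) = r *\<^sub>R f x" using tendsto_unique[OF ne f] by blast
  qed
  \<comment> \<open>Letting \<open>\<psi>'\<close> run along \<open>F\<close> replaces it by the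
    pointwise limit \<open>f\<close>, uniformly on \<open>W\<close>. This serves both the
    boundedness of \<open>f\<close> and the final convergence.\<close>
  have close: "\<bar>blinfun_apply \<psi> x - f x\<bar> \<le> e"
    if "\<forall>\<^sub>F \<psi> in F. \<psi> \<in> A"
      "\<forall>\<psi>\<in>A. \<forall>\<psi>'\<in>A. \<forall>x\<in>W. \<bar>blinfun_apply \<psi> x - blinfun_apply \<psi>' x\<bar> < e"
      "\<psi> \<in> A" "x \<in> W" for A W e \<psi> x
  proof (rule tendsto_upperbound[OF _ _ ne])
    show "((\<lambda>\<psi>'. \<bar>blinfun_apply \<psi> x - blinfun_apply \<psi>' x\<bar>) \<longlongrightarrow> \<bar>blinfun_apply \<psi> x - f x\<bar>) F"
      by (intro tendsto_intros f)
    show "\<forall>\<^sub>F \<psi>' in F. \<bar>blinfun_apply \<psi> x - blinfun_apply \<psi>' x\<bar> \<le> e"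
      using that(1) by eventually_elim (use that in \<open>auto intro: less_imp_le\<close>)
  qed
  have "\<exists>K. \<forall>x. \<bar>f x\<bar> \<le> norm x * K"
  proof (rule ccontr)
    assume "\<not> ?thesis"
    then have "\<forall>n::nat. \<exists>x. norm x * (real (Suc n))\<^sup>2 < \<bar>f x\<bar>" by (meson not_le)
    then obtain y where y: "\<And>n::nat. norm (y n) * (real (Suc n))\<^sup>2 < \<bar>f (y n)\<bar>" by metis
    have y0: "0 < norm (y n)" for n using y[of n] by (auto simp: linear_0[OF lin])
    \<comment> \<open>Rescaled to norm \<open>1 / Suc n\<close>, the vectors form a null sequence on
      which \<open>f\<close> is unbounded. But on their hull \<open>f\<close> stays within 1 of a
      bounded functional \<open>\<psi>\<close>.\<close>
    define x where "x n = (inverse (real (Suc n)) / norm (y n)) *\<^sub>R y n" for n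
    have nx: "norm (x n) = inverse (real (Suc n))" for n using y0[of n] by (simp add: x_def)
    have fx: "real (Suc n) < \<bar>f (x n)\<bar>" for n
    proof -
      have "\<bar>f (x n)\<bar> = inverse (real (Suc n)) / norm (y n) * \<bar>f (y n)\<bar>"
        using y0[of n] by (simp add: x_def linear_scale[OF lin] abs_mult)
      moreover have "inverse (real (Suc n)) / norm (y n) * (norm (y n) * (real (Suc n))\<^sup>2) < inverse (real (Suc n)) / norm (y n) * \<bar>f (y n)\<bar>"
        using y[of n] y0[of n] by (intro mult_strict_left_mono) auto
      moreover have "inverse (real (Suc n)) / norm (y n) * (norm (y n) * (real (Suc n))\<^sup>2) = real (Suc n)"
        using y0[of n] by (simp add: power2_eq_square del: of_nat_Suc)
      ultimately show ?thesis by linarith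
    qed
    have "x \<longlonglongrightarrow> 0"
      by (rule Lim_null_comparison[OF _ LIMSEQ_inverse_real_of_nat]) (simp add: nx)
    then have null: "(\<lambda>n. blinfun_apply \<phi> (x n)) \<longlonglongrightarrow> 0" for \<phi> :: "'e \<Rightarrow>\<^sub>L real"
      using blinfun.tendsto[OF tendsto_const[of \<phi>], of x 0] by simp
    have "norm (x n) \<le> 1" for n by (simp add: nx inverse_le_1_iff)
    then obtain W where W: "W \<in> mackey_sets" "range x \<subseteq> W"
      using weakly_null_hull[OF compl _ null] by blast
    obtain A where A: "\<forall>\<^sub>F \<psi> in F. \<psi> \<in> A"
        "\<forall>\<psi>\<in>A. \<forall>\<psi>'\<in>A. \<forall>x\<in>W. \<bar>blinfun_apply \<psi> x - blinfun_apply \<psi>' x\<bar> < 1"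
      using cauchy_filter_mackeyD[OF F W(1), of 1] by auto
    obtain \<psi> where \<psi>: "\<psi> \<in> A" using eventually_happens[OF A(1)] ne by blast
    obtain n where n: "norm \<psi> + 1 < real n" using reals_Archimedean2 by blast
    have "\<bar>blinfun_apply \<psi> (x n) - f (x n)\<bar> \<le> 1" by (rule close[OF A \<psi>]) (use W in auto)
    moreover have "\<bar>blinfun_apply \<psi> (x n)\<bar> \<le> norm \<psi>"
    proof -
      have "\<bar>blinfun_apply \<psi> (x n)\<bar> \<le> norm \<psi> * norm (x n)" using norm_blinfun[of \<psi> "x n"] by simp
      also have "\<dots> \<le> norm \<psi> * 1" using \<open>norm (x n) \<le> 1\<close> by (intro mult_left_mono) auto
      finally show ?thesis by simp
    qed
    ultimately show False using fx[of n] n by simp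
  qed
  then have "bounded_linear f"
    using lin by (auto simp: bounded_linear_def bounded_linear_axioms_def)
  then obtain \<phi> where \<phi>: "f = blinfun_apply \<phi>" using bounded_linear_Blinfun_apply by metis
  have "limitin mackey_dual (\<lambda>\<psi>. \<psi>) \<phi> F"
    unfolding mackey_dual_def
  proof (rule limitin_unif_conv_topologyI, rule uniform_limitI)
    fix W :: "'e set" and e :: real assume W: "W \<in> mackey_sets" and "0 < e"
    then obtain A where A: "\<forall>\<^sub>F \<psi> in F. \<psi> \<in> A"
        "\<forall>\<psi>\<in>A. \<forall>\<psi>'\<in>A. \<forall>x\<in>W. \<bar>blinfun_apply \<psi> x - blinfun_apply \<psi>' x\<bar> < e / 2"
      using cauchy_filter_mackeyD[OF F W, of "e / 2"] \<open>0 < e\<close> by auto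
    show "\<forall>\<^sub>F \<psi> in F. \<forall>x\<in>W. dist (blinfun_apply \<psi> x) (blinfun_apply \<phi> x) < e"
      using A(1)
    proof eventually_elim
      case (elim \<psi>)
      show ?case
      proof
        fix x assume "x \<in> W"
        have "\<bar>blinfun_apply \<psi> x - f x\<bar> \<le> e / 2" by (rule close[OF A elim \<open>x \<in> W\<close>])
        then show "dist (blinfun_apply \<psi> x) (blinfun_apply \<phi> x) < e"
          using \<open>0 < e\<close> by (simp add: dist_real_def \<phi>)
      qed
    qed
  qed
  then show "\<exists>l. limitin mackey_dual (\<lambda>x. x) l F" by blast
qed

section \<open>The Mackey dual of \<open>C(K)\<close>\<close>

context
  assumes K: "compact (UNIV :: 'k::topological_space set)"
begin

text \<open>Continuous functions on a compact space are bounded, so the type of bounded continuous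
  functions is all of \<open>C(K)\<close>.\<close>

lemma apply_Bcontfun:
  fixes f :: "'k \<Rightarrow> real"
  assumes "continuous_on UNIV f"
  shows "apply_bcontfun (Bcontfun f) = f"
  using assms compact_imp_bounded[OF compact_continuous_image[OF assms K]]
  by (intro Bcontfun_inverse) (simp add: bcontfun_def)

lemma bounded_functional_blinfun:
  fixes \<phi> :: "('k \<Rightarrow>\<^sub>C real) \<Rightarrow>\<^sub>L real"
  assumes "0 \<le> C" "\<And>f. \<bar>blinfun_apply \<phi> f\<bar> \<le> C * norm f"
  shows "bounded_functional C (\<lambda>f. blinfun_apply \<phi> (Bcontfun f))"
  unfolding bounded_functional_def
proof (intro conjI allI impI)
  fix f g :: "'k \<Rightarrow> real" assume c: "continuous_on UNIV f" "continuous_on UNIV g"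
  have "Bcontfun (\<lambda>x. f x + g x) = Bcontfun f + Bcontfun g"
    using c by (intro bcontfun_eqI) (simp add: apply_Bcontfun continuous_on_add)
  then show "blinfun_apply \<phi> (Bcontfun (\<lambda>x. f x + g x)) = blinfun_apply \<phi> (Bcontfun f) + blinfun_apply \<phi> (Bcontfun g)"
    by (simp add: blinfun.add_right)
next
  fix f :: "'k \<Rightarrow> real" and c assume f: "continuous_on UNIV f"
  have "Bcontfun (\<lambda>x. c * f x) = c *\<^sub>R Bcontfun f"
    using f by (intro bcontfun_eqI) (simp add: apply_Bcontfun continuous_on_mult_left)
  then show "blinfun_apply \<phi> (Bcontfun (\<lambda>x. c * f x)) = c * blinfun_apply \<phi> (Bcontfun f)"
    by (simp add: blinfun.scaleR_right)
next
  fix f :: "'k \<Rightarrow> real" and b assume f: "continuous_on UNIV f" "\<forall>x. \<bar>f x\<bar> \<le> b"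
  have "norm (Bcontfun f) \<le> b" using f by (intro norm_bound) (simp add: apply_Bcontfun)
  then show "\<bar>blinfun_apply \<phi> (Bcontfun f)\<bar> \<le> C * b"
    using assms(2)[of "Bcontfun f"] mult_left_mono[OF _ assms(1)] order_trans by blast
qed

end

lemma bounded_linear_eval: "bounded_linear (\<lambda>f :: 'k::topological_space \<Rightarrow>\<^sub>C real. apply_bcontfun f x)"
  by (rule bounded_linear_intro[of _ 1]) (auto intro: norm_bounded[where 'b = real, unfolded real_norm_def])

definition delta :: "'k::topological_space \<Rightarrow> ('k \<Rightarrow>\<^sub>C real) \<Rightarrow>\<^sub>L real" where
  "delta x = Blinfun (\<lambda>f. apply_bcontfun f x)"

lemma blinfun_apply_delta [simp]: "blinfun_apply (delta x) = (\<lambda>f. apply_bcontfun f x)"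
  unfolding delta_def by (simp add: bounded_linear_Blinfun_apply bounded_linear_eval)

lemma norm_delta_le: "norm (delta x) \<le> 1"
  by (rule norm_blinfun_bound) (auto intro: norm_bounded[where 'b = real, unfolded real_norm_def])

section \<open>Weakly compact sets in \<open>C(K)\<close> and Eberlein's theorem\<close>

text \<open>Point evaluations are bounded functionals, so the weak topology is finer than the
  pointwise one, in which the Eberlein argument takes place.\<close>

lemma compact_pointwise:
  fixes W :: "('k::topological_space \<Rightarrow>\<^sub>C real) set"
  assumes "compactin (weak_of euclidean) W"
  shows "compact (apply_bcontfun ` W)"
proof -
  have "continuous_map (weak_of (euclidean :: ('k \<Rightarrow>\<^sub>C real) topology)) (product_topology (\<lambda>_. euclideanreal) UNIV) apply_bcontfun"
    unfolding continuous_map_componentwise_UNIV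
  proof
    show "continuous_map (weak_of euclidean) euclideanreal (\<lambda>f. apply_bcontfun f x)" for x :: 'k
      using continuous_map_weak_blinfun[of "delta x"] by simp
  qed
  then have "continuous_map (weak_of (euclidean :: ('k \<Rightarrow>\<^sub>C real) topology)) euclidean apply_bcontfun"
    by (simp add: euclidean_product_topology)
  then show ?thesis using image_compactin[OF assms] by fastforce
qed

text \<open>Each functional is bounded on \<open>W\<close>. Uniform boundedness is applied to the
  members of \<open>W\<close> acting on the dual, and evaluating at \<open>delta x\<close> bounds
  the values.\<close>

lemma weakly_compact_bounded:
  fixes W :: "('k::topological_space \<Rightarrow>\<^sub>C real) set"
  assumes W: "compactin (weak_of euclidean) W"
  shows "\<exists>B>0. \<forall>w\<in>W. \<forall>x. \<bar>apply_bcontfun w x\<bar> \<le> B"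
proof -
  have "\<exists>C. \<forall>w\<in>W. \<forall>\<psi> :: ('k \<Rightarrow>\<^sub>C real) \<Rightarrow>\<^sub>L real. norm (blinfun_apply \<psi> w) \<le> C * norm \<psi>"
  proof (rule uniform_boundedness[OF complete_UNIV])
    show "bounded_linear (\<lambda>\<psi> :: ('k \<Rightarrow>\<^sub>C real) \<Rightarrow>\<^sub>L real. blinfun_apply \<psi> w)" for w
      by (rule blinfun.bounded_linear_left)
    fix \<psi> :: "('k \<Rightarrow>\<^sub>C real) \<Rightarrow>\<^sub>L real"
    have "compact (blinfun_apply \<psi> ` W)"
      using image_compactin[OF W continuous_map_weak_blinfun] by simp
    then have "bounded (blinfun_apply \<psi> ` W)" by (rule compact_imp_bounded)
    then show "\<exists>c. \<forall>w\<in>W. norm (blinfun_apply \<psi> w) \<le> c"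
      unfolding bounded_iff by simp
  qed
  then obtain C where C: "\<And>w \<psi>. w \<in> W \<Longrightarrow> norm (blinfun_apply \<psi> w) \<le> C * norm (\<psi> :: ('k \<Rightarrow>\<^sub>C real) \<Rightarrow>\<^sub>L real)"
    by blast
  have "\<bar>apply_bcontfun w x\<bar> \<le> \<bar>C\<bar> + 1" if "w \<in> W" for w x
  proof -
    have "\<bar>apply_bcontfun w x\<bar> \<le> C * norm (delta x)" using C[OF that, of "delta x"] by simp
    also have "\<dots> \<le> \<bar>C\<bar> * 1" using norm_delta_le[of x] by (intro mult_mono) auto
    finally show ?thesis by simp
  qed
  then show ?thesis by (intro exI[of _ "\<bar>C\<bar> + 1"]) auto
qed

lemma tendsto_coordinate:
  fixes G :: "'a \<Rightarrow> 'b::topological_space"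
  shows "((\<lambda>h. h y) \<longlongrightarrow> G y) (nhds G)"
proof (rule topological_tendstoI)
  fix U :: "'b set" assume "open U" "G y \<in> U"
  moreover have "open ((\<lambda>h::'a \<Rightarrow> 'b. h y) -` U)"
    by (rule open_vimage[OF \<open>open U\<close>]) simp
  ultimately show "\<forall>\<^sub>F h in nhds G. h y \<in> U"
    unfolding eventually_nhds by (intro exI[of _ "(\<lambda>h. h y) -` U"]) simp
qed

text \<open>The product topology need not be first countable, so a cluster point is witnessed by a
  filter refining the sequence instead of a subsequence.\<close>

lemma pointwise_cluster:
  fixes s :: "nat \<Rightarrow> 'a \<Rightarrow> real"
  assumes P: "compact P" "\<And>n. s n \<in> P"
  obtains G F where "G \<in> P" "F \<noteq> bot" "F \<le> filtermap s sequentially" "\<And>y. ((\<lambda>h. h y) \<longlongrightarrow> G y) F"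
proof -
  have "filtermap s sequentially \<noteq> bot" by (simp add: filtermap_bot_iff)
  moreover have "eventually (\<lambda>h. h \<in> P) (filtermap s sequentially)" by (simp add: eventually_filtermap P)
  ultimately obtain G where G: "G \<in> P" "inf (nhds G) (filtermap s sequentially) \<noteq> bot"
    using P(1) unfolding compact_filter by blast
  have "((\<lambda>h. h y) \<longlongrightarrow> G y) (inf (nhds G) (filtermap s sequentially))" for y
    by (rule tendsto_mono[OF _ tendsto_coordinate]) simp
  then show ?thesis using that[OF G] by simp
qed

lemma tendsto_along_cluster:
  assumes "F \<le> filtermap s sequentially" "(\<lambda>n. s n y) \<longlonglongrightarrow> l"
  shows "((\<lambda>h. h y) \<longlongrightarrow> l) F"
  using assms tendsto_mono[OF assms(1), of "\<lambda>h. h y" l] by (simp add: filterlim_filtermap)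

text \<open>Eberlein. The map \<open>x \<mapsto> (f n x)\<^sub>n\<close> has a separable range, so a countable set \<open>D\<close> controls
  all cluster points of \<open>f\<close>: these factor through that map and are continuous.\<close>

lemma pointwise_compact_subsequence:
  fixes f :: "nat \<Rightarrow> 'k::topological_space \<Rightarrow> real"
  assumes K: "compact (UNIV :: 'k set)" and P: "compact P" and cont: "\<And>g. g \<in> P \<Longrightarrow> continuous_on UNIV g"
    and fP: "\<And>n. f n \<in> P"
  obtains r G where "strict_mono r" "G \<in> P" "\<And>x. (\<lambda>n. f (r n) x) \<longlonglongrightarrow> G x"
proof -
  define \<Phi> where "\<Phi> x n = f n x" for x n
  have cont\<Phi>: "continuous_on UNIV \<Phi>"
    by (rule continuous_on_coordinatewise_then_product) (simp add: \<Phi>_def cont fP)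
  obtain \<B> :: "(nat \<Rightarrow> real) set set" where \<B>: "countable \<B>" "topological_basis \<B>"
    using ex_countable_basis by blast
  \<comment> \<open>One point for each basic open set that meets the range makes the image of
    \<open>D\<close> dense in it. Compactness of \<open>closure D\<close> then makes
    \<open>\<Phi>\<close> map it onto the whole range.\<close>
  define D where "D = (\<lambda>b. SOME x. \<Phi> x \<in> b) ` \<B>"
  have D: "countable D" using \<B>(1) by (simp add: D_def)
  have dense: "range \<Phi> \<subseteq> closure (\<Phi> ` D)"
  proof
    fix z assume "z \<in> range \<Phi>"
    then obtain x where x: "z = \<Phi> x" by blast
    have "\<Phi> ` D \<inter> U \<noteq> {}" if "open U" "z \<in> U" for U
    proof -
      obtain b where b: "b \<in> \<B>" "z \<in> b" "b \<subseteq> U"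
        using topological_basisE[OF \<B>(2) \<open>open U\<close> \<open>z \<in> U\<close>] by blast
      have "\<Phi> (SOME x. \<Phi> x \<in> b) \<in> b" by (rule someI[of _ x]) (use x b in simp)
      then show ?thesis using b unfolding D_def by blast
    qed
    then show "z \<in> closure (\<Phi> ` D)" unfolding closure_iff_nhds_not_empty by blast
  qed
  have "compact (\<Phi> ` closure D)"
    using compact_Int_closed[OF K closed_closure[of D]] cont\<Phi>
    by (intro compact_continuous_image) (auto intro: continuous_on_subset)
  then have "closed (\<Phi> ` closure D)" by (rule compact_imp_closed)
  moreover have "\<Phi> ` D \<subseteq> \<Phi> ` closure D" using closure_subset by (rule image_mono)
  ultimately have "range \<Phi> \<subseteq> \<Phi> ` closure D" using dense closure_minimal by blast
  then have "\<Phi> x \<in> \<Phi> ` closure D" for x by blast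
  then have factor: "\<exists>y\<in>closure D. \<forall>n. f n x = f n y" for x
    unfolding \<Phi>_def image_iff fun_eq_iff .
  have "\<B> \<noteq> {}"
    using topological_basisE[OF \<B>(2) open_UNIV UNIV_I] by blast
  then have "D \<noteq> {}" by (simp add: D_def)
  define d where "d = from_nat_into D"
  have d: "range d = D" unfolding d_def by (rule range_from_nat_into[OF \<open>D \<noteq> {}\<close> D])
  \<comment> \<open>Restriction to the countable set \<open>D\<close> maps \<open>P\<close> to a
    compact set of real sequences, where sequential compactness provides \<open>r\<close>.\<close>
  have "continuous_on UNIV (\<lambda>(g::'k \<Rightarrow> real) (i::nat). g (d i))"
    by (rule continuous_on_coordinatewise_then_product) simp
  then have "compact ((\<lambda>g i. g (d i)) ` P)"
    using P by (intro compact_continuous_image) (auto intro: continuous_on_subset)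
  then have "seq_compact ((\<lambda>g i. g (d i)) ` P)" by (simp add: seq_compact_eq_compact)
  moreover have "\<forall>n. (\<lambda>i. f n (d i)) \<in> (\<lambda>g i. g (d i)) ` P" using fP by blast
  ultimately obtain z r where r: "strict_mono r" "((\<lambda>n i. f n (d i)) \<circ> r) \<longlonglongrightarrow> z"
    by (rule seq_compactE)
  have conv: "(\<lambda>n. f (r n) (d i)) \<longlonglongrightarrow> z i" for i
    using filterlim_compose[OF tendsto_coordinate r(2)] by (simp add: o_def)
  obtain G F where G: "G \<in> P" "F \<noteq> bot" "F \<le> filtermap (\<lambda>n. f (r n)) sequentially" "\<And>y. ((\<lambda>h. h y) \<longlongrightarrow> G y) F"
    using pointwise_cluster[OF P, of "\<lambda>n. f (r n)"] fP by metis
  \<comment> \<open>Two cluster points agree on \<open>D\<close> by convergence there, on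
    \<open>closure D\<close> by continuity, and everywhere because they take equal values at points
    that no \<open>f n\<close> separates.\<close>
  have unique: "G' x = G x"
    if G': "G' \<in> P" "F' \<noteq> bot" "F' \<le> filtermap (\<lambda>n. f (r (q n))) sequentially"
      "\<And>y. ((\<lambda>h. h y) \<longlongrightarrow> G' y) F'" and q: "strict_mono q" for G' F' q x
  proof -
    have on_D: "G' y = G y" if "y \<in> D" for y
    proof -
      obtain i where i: "y = d i" using d \<open>y \<in> D\<close> by blast
      have "G y = z i"
        unfolding i by (rule tendsto_unique[OF G(2) G(4) tendsto_along_cluster[OF G(3) conv]])
      moreover have "(\<lambda>n. f (r (q n)) (d i)) \<longlonglongrightarrow> z i"
        using LIMSEQ_subseq_LIMSEQ[OF conv q] by (simp add: o_def)
      then have "G' y = z i"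
        unfolding i by (rule tendsto_unique[OF G'(2) G'(4) tendsto_along_cluster[OF G'(3)]])
      ultimately show ?thesis by simp
    qed
    have "closed {y. G' y = G y}"
      by (rule closed_Collect_eq) (auto intro: cont G G')
    then have on_closure: "G' y = G y" if "y \<in> closure D" for y
      using on_D closure_minimal[of D "{y. G' y = G y}"] that by blast
    obtain y where y: "y \<in> closure D" "\<And>n. f n x = f n y" using factor by blast
    have "(\<lambda>n. f (r n) y - f (r n) x) \<longlonglongrightarrow> 0" "(\<lambda>n. f (r (q n)) y - f (r (q n)) x) \<longlonglongrightarrow> 0"
      by (simp_all add: y)
    then have "((\<lambda>h. h y - h x) \<longlongrightarrow> 0) F" "((\<lambda>h. h y - h x) \<longlongrightarrow> 0) F'"
      using tendsto_mono[OF G(3), of "\<lambda>h. h y - h x"] tendsto_mono[OF G'(3), of "\<lambda>h. h y - h x"]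
      by (simp_all add: filterlim_filtermap)
    then have "G y - G x = 0" "G' y - G' x = 0"
      using tendsto_unique[OF G(2) tendsto_diff[OF G(4) G(4)]] tendsto_unique[OF G'(2) tendsto_diff[OF G'(4) G'(4)]]
      by blast+
    then show ?thesis using on_closure[OF y(1)] by simp
  qed
  \<comment> \<open>If convergence fails at \<open>x\<close>, a subsequence staying away from
    \<open>G x\<close> has a cluster point that differs from \<open>G\<close> at
    \<open>x\<close>.\<close>
  have "(\<lambda>n. f (r n) x) \<longlonglongrightarrow> G x" for x
  proof (rule ccontr)
    assume "\<not> ?thesis"
    then obtain e where e: "0 < e" "\<not> (\<forall>\<^sub>F n in sequentially. dist (f (r n) x) (G x) < e)"
      unfolding tendsto_iff by blast
    then have "infinite {n. \<not> dist (f (r n) x) (G x) < e}"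
      unfolding cofinite_eq_sequentially[symmetric] eventually_cofinite by simp
    then obtain q :: "nat \<Rightarrow> nat" where "strict_mono q" "\<forall>n. q n \<in> {n. \<not> dist (f (r n) x) (G x) < e}"
      using infinite_enumerate by blast
    then have q: "strict_mono q" "\<And>n. \<not> dist (f (r (q n)) x) (G x) < e" by auto
    obtain G' F' where G': "G' \<in> P" "F' \<noteq> bot" "F' \<le> filtermap (\<lambda>n. f (r (q n))) sequentially" "\<And>y. ((\<lambda>h. h y) \<longlongrightarrow> G' y) F'"
      using pointwise_cluster[OF P, of "\<lambda>n. f (r (q n))"] fP by metis
    have "((\<lambda>h. h x) \<longlongrightarrow> G x) F'" using G'(4)[of x] unique[OF G' q(1), of x] by simp
    then have "\<forall>\<^sub>F h in F'. dist (h x) (G x) < e" using e(1) by (rule tendstoD)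
    moreover have "\<forall>\<^sub>F h in F'. \<not> dist (h x) (G x) < e"
      using filter_leD[OF G'(3)] q(2) by (simp add: eventually_filtermap)
    ultimately have "\<forall>\<^sub>F h in F'. False" by eventually_elim simp
    then show False using G'(2) by (simp add: trivial_limit_def)
  qed
  then show ?thesis using that[OF r(1) G(1)] by blast
qed

section \<open>Uniform convergence on weakly compact sets and the Schur property\<close>

text \<open>Otherwise some \<open>w n\<close> in \<open>W\<close> keep
  \<open>\<bar>\<phi> (r n) (w n)\<bar>\<close> at least \<open>e\<close>. By Eberlein a subsequence
  converges pointwise to some \<open>g\<close> in \<open>W\<close>. The functionals tend to 0 at
  \<open>g\<close>, and the differences from \<open>g\<close> become uniformly small for all of
  them.\<close>

lemma weak_star_null_uniform:
  fixes \<phi> :: "nat \<Rightarrow> ('k::topological_space \<Rightarrow>\<^sub>C real) \<Rightarrow>\<^sub>L real"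
  assumes K: "compact (UNIV :: 'k set)" and F: "F_space (euclidean :: 'k topology)"
    and null: "\<And>f. (\<lambda>n. blinfun_apply (\<phi> n) f) \<longlonglongrightarrow> 0"
    and W: "compactin (weak_of euclidean) W" and "0 < e"
  shows "\<forall>\<^sub>F n in sequentially. \<forall>w\<in>W. \<bar>blinfun_apply (\<phi> n) w\<bar> < e"
proof (rule ccontr)
  assume "\<not> ?thesis"
  then have "infinite {n. \<not> (\<forall>w\<in>W. \<bar>blinfun_apply (\<phi> n) w\<bar> < e)}"
    unfolding cofinite_eq_sequentially[symmetric] eventually_cofinite by simp
  then obtain r :: "nat \<Rightarrow> nat" where "strict_mono r"
    "\<forall>n. r n \<in> {n. \<not> (\<forall>w\<in>W. \<bar>blinfun_apply (\<phi> n) w\<bar> < e)}"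
    using infinite_enumerate by blast
  then have r: "strict_mono r" "\<And>n. \<exists>w\<in>W. e \<le> \<bar>blinfun_apply (\<phi> (r n)) w\<bar>" by (auto simp: not_less)
  then obtain w where w: "\<And>n. w n \<in> W" "\<And>n. e \<le> \<bar>blinfun_apply (\<phi> (r n)) (w n)\<bar>" by metis
  obtain q G where q: "strict_mono q" "G \<in> apply_bcontfun ` W" "\<And>x. (\<lambda>n. apply_bcontfun (w (q n)) x) \<longlonglongrightarrow> G x"
  proof (rule pointwise_compact_subsequence[OF K compact_pointwise[OF W], of "\<lambda>n. apply_bcontfun (w n)"])
    show "continuous_on UNIV g" if "g \<in> apply_bcontfun ` W" for g using that by auto
    show "apply_bcontfun (w n) \<in> apply_bcontfun ` W" for n using w(1) by blast
  qed (rule that)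
  then obtain g where g: "g \<in> W" "G = apply_bcontfun g" by blast
  obtain B where B: "0 < B" "\<And>v x. v \<in> W \<Longrightarrow> \<bar>apply_bcontfun v x\<bar> \<le> B"
    using weakly_compact_bounded[OF W] by blast
  have "\<exists>C. \<forall>n\<in>UNIV. \<forall>f. norm (blinfun_apply (\<phi> n) f) \<le> C * norm f"
  proof (rule uniform_boundedness[OF complete_UNIV_bcontfun])
    fix f
    have "Bseq (\<lambda>n. blinfun_apply (\<phi> n) f)" using null[of f] by (intro convergent_imp_Bseq) (auto simp: convergent_def)
    then show "\<exists>c. \<forall>n\<in>UNIV. norm (blinfun_apply (\<phi> n) f) \<le> c" unfolding Bseq_def by blast
  qed (rule blinfun.bounded_linear_right)
  then obtain C where C: "\<And>n f. \<bar>blinfun_apply (\<phi> n) f\<bar> \<le> C * norm f" by auto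
  have C': "\<bar>blinfun_apply (\<phi> n) f\<bar> \<le> \<bar>C\<bar> * norm f" for n f
    using C[of n f] mult_right_mono[OF abs_ge_self norm_ge_zero, of C f] by linarith
  define L where "L n f = blinfun_apply (\<phi> n) (Bcontfun f)" for n f
  have L: "bounded_functional \<bar>C\<bar> (L n)" for n
    unfolding L_def by (rule bounded_functional_blinfun[OF K _ C']) simp
  have L_apply: "L n (apply_bcontfun f) = blinfun_apply (\<phi> n) f" for n f
    by (simp add: L_def apply_bcontfun_inverse)
  have "(\<lambda>n. blinfun_apply (\<phi> (r (q n))) g) \<longlonglongrightarrow> 0"
    using LIMSEQ_subseq_LIMSEQ[OF null[of g] strict_mono_o[OF r(1) q(1)]] by (simp add: o_def)
  then obtain N where N: "\<And>n. N \<le> n \<Longrightarrow> \<bar>blinfun_apply (\<phi> (r (q n))) g\<bar> < e / 2"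
    using \<open>0 < e\<close> tendstoD[of _ 0 sequentially "e / 2"] by (force simp: eventually_sequentially)
  \<comment> \<open>Dividing by \<open>2 * B\<close> brings the differences into the unit ball, and
    the shift by \<open>N\<close> keeps the values at \<open>g\<close> below \<open>e / 2\<close>.
    The bound \<open>e / (8 * B)\<close> scales back to \<open>e / 4\<close>, and
    \<open>e / 4 + e / 2 < e\<close>.\<close>
  define v where "v n = (1 / (2 * B)) *\<^sub>R (w (q (n + N)) - g)" for n
  have "\<exists>n. uniformly_small L (\<lambda>x. \<bar>apply_bcontfun (v n) x\<bar>) (e / (8 * B))"
  proof (rule uniformly_small_pointwise_null[OF K F L])
    show "(\<lambda>n. L n f) \<longlonglongrightarrow> 0" if "continuous_on UNIV f" for f unfolding L_def by (rule null)
    show "continuous_on UNIV (\<lambda>x. \<bar>apply_bcontfun (v i) x\<bar>)" for i by (intro continuous_intros) simp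
    show "\<bar>apply_bcontfun (v i) x\<bar> \<le> 1" for i x
    proof -
      have "\<bar>apply_bcontfun (w (q (i + N))) x - apply_bcontfun g x\<bar> \<le> 2 * B"
        using B(2)[OF w(1), of "q (i + N)" x] B(2)[OF g(1), of x] by linarith
      then show ?thesis using B(1) by (simp add: v_def abs_mult field_simps)
    qed
    show "(\<lambda>i. \<bar>apply_bcontfun (v i) x\<bar>) \<longlonglongrightarrow> 0" for x
    proof -
      have "(\<lambda>i. apply_bcontfun (w (q (i + N))) x) \<longlonglongrightarrow> apply_bcontfun g x"
        using LIMSEQ_ignore_initial_segment[OF q(3)] g(2) by simp
      then have "(\<lambda>i. (1 / (2 * B)) * (apply_bcontfun (w (q (i + N))) x - apply_bcontfun g x)) \<longlonglongrightarrow> (1 / (2 * B)) * (apply_bcontfun g x - apply_bcontfun g x)"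
        by (intro tendsto_intros)
      then have "(\<lambda>i. (1 / (2 * B)) * (apply_bcontfun (w (q (i + N))) x - apply_bcontfun g x)) \<longlonglongrightarrow> 0" by simp
      from tendsto_rabs_zero[OF this] show ?thesis by (simp add: v_def)
    qed
  qed (use B(1) \<open>0 < e\<close> in auto)
  then obtain n where n: "uniformly_small L (\<lambda>x. \<bar>apply_bcontfun (v n) x\<bar>) (e / (8 * B))" by blast
  let ?k = "r (q (n + N))"
  have "\<bar>blinfun_apply (\<phi> ?k) (v n)\<bar> \<le> e / (8 * B)"
    using n unfolding uniformly_small_def L_apply[symmetric] by simp
  then have "\<bar>blinfun_apply (\<phi> ?k) (w (q (n + N))) - blinfun_apply (\<phi> ?k) g\<bar> \<le> e / 4"
    using B(1) by (simp add: v_def blinfun.scaleR_right blinfun.diff_right abs_mult field_simps)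
  then show False using w(2)[of "q (n + N)"] N[of "n + N"] \<open>0 < e\<close> by linarith
qed

lemma continuous_map_mackey_eval:
  "continuous_map mackey_dual euclideanreal (\<lambda>\<psi>. blinfun_apply \<psi> x)"
  unfolding continuous_map_def
proof (intro conjI allI impI)
  fix U :: "real set" assume "openin euclidean U"
  then have U: "open U" by simp
  have "\<forall>\<^sub>F \<psi> in unif_conv_nhds mackey_sets \<phi>. blinfun_apply \<psi> x \<in> U" if \<phi>: "blinfun_apply \<phi> x \<in> U" for \<phi>
  proof -
    obtain e where e: "0 < e" "ball (blinfun_apply \<phi> x) e \<subseteq> U" using openE[OF U \<phi>] by blast
    have x: "x \<in> (\<lambda>a. a *\<^sub>R x) ` {-1..1}" by (rule image_eqI[of _ _ 1]) auto
    show ?thesis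
      using eventually_unif_conv_nhds[OF segment_mackey_set e(1), of x \<phi>]
    proof eventually_elim
      case (elim \<psi>)
      then have "\<bar>blinfun_apply \<psi> x - blinfun_apply \<phi> x\<bar> < e" using x by blast
      then show ?case using e(2) by (auto simp: dist_real_def abs_minus_commute)
    qed
  qed
  then show "openin mackey_dual {\<psi> \<in> topspace mackey_dual. blinfun_apply \<psi> x \<in> U}"
    by (simp add: mackey_dual_def openin_unif_conv_topology)
qed auto

text \<open>Evaluations at elements of \<open>C(K)\<close> are Mackey continuous, so weak
  convergence implies weak* convergence, which is uniform on every Mackey set by
  \<open>weak_star_null_uniform\<close>.\<close>

lemma Schur_mackey_dual:
  assumes K: "compact (UNIV :: 'k::topological_space set)" and F: "F_space (euclidean :: 'k topology)"
  shows "Schur_property (mackey_dual :: (('k \<Rightarrow>\<^sub>C real) \<Rightarrow>\<^sub>L real) topology)"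
  unfolding Schur_property_def
proof (intro allI iffI)
  fix s :: "nat \<Rightarrow> ('k \<Rightarrow>\<^sub>C real) \<Rightarrow>\<^sub>L real" and l
  show "limitin (weak_of mackey_dual) s l sequentially" if "limitin mackey_dual s l sequentially"
    by (rule limitin_weak_ofI[OF _ that]) (simp add: mackey_dual_def)
  assume lim: "limitin (weak_of mackey_dual) s l sequentially"
  have "(\<lambda>n. blinfun_apply (s n) f) \<longlonglongrightarrow> blinfun_apply l f" for f
  proof -
    have "continuous_map (weak_of mackey_dual) euclideanreal (\<lambda>\<psi>. blinfun_apply \<psi> f)"
      by (rule continuous_map_from_weak_of[OF _ continuous_map_mackey_eval])
        (rule bounded_linear.linear[OF blinfun.bounded_linear_left])
    from continuous_map_limit[OF this lim] show ?thesis by (simp add: o_def)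
  qed
  then have null: "(\<lambda>n. blinfun_apply (s n - l) f) \<longlonglongrightarrow> 0" for f
    by (simp add: blinfun.diff_left LIM_zero)
  show "limitin mackey_dual s l sequentially"
    unfolding mackey_dual_def
  proof (rule limitin_unif_conv_topologyI, rule uniform_limitI)
    fix W :: "('k \<Rightarrow>\<^sub>C real) set" and e :: real assume "W \<in> mackey_sets" "0 < e"
    then show "\<forall>\<^sub>F n in sequentially. \<forall>f\<in>W. dist (blinfun_apply (s n) f) (blinfun_apply l f) < e"
      using weak_star_null_uniform[OF K F null, of W e] by (simp add: dist_real_def blinfun.diff_left)
  qed
qed

section \<open>Disjoint bumps and a weakly compact set that is not Mackey compact\<close>

text \<open>Separate two points of \<open>S\<close> by open sets. If the closure of the first leaves
  only finitely many points of \<open>S\<close>, the second is finite within \<open>S\<close>, hence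
  closed, and removing it leaves infinitely many.\<close>

lemma Hausdorff_split_open:
  fixes S :: "'k::topological_space set"
  assumes H: "Hausdorff_space (euclidean :: 'k topology)" and S: "open S" "infinite S"
  shows "\<exists>U. open U \<and> U \<noteq> {} \<and> U \<subseteq> S \<and> infinite (S - closure U)"
proof -
  obtain x where x: "x \<in> S" using S(2) by fastforce
  obtain y where y: "y \<in> S" "y \<noteq> x" using S(2) by (metis finite.emptyI finite.insertI finite_subset insert_iff subsetI)
  obtain A B where AB: "open A" "open B" "x \<in> A" "y \<in> B" "disjnt A B"
    using H y(2) unfolding Hausdorff_space_def by auto metis
  let ?U = "A \<inter> S" and ?V = "B \<inter> S"
  show ?thesis
  proof (cases "infinite (S - closure ?U)")
    case True
    then show ?thesis using AB x S by (intro exI[of _ ?U]) auto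
  next
    case False
    have "?V \<inter> closure ?U = {}"
      using open_Int_closure_eq_empty[of ?V ?U] AB S by (auto simp: disjnt_def)
    then have "?V \<subseteq> S - closure ?U" by blast
    then have fin: "finite ?V" using False finite_subset by blast
    have "closed ?V"
      using closedin_Hausdorff_finite[OF H, of ?V] fin by simp
    then have "infinite (S - closure ?V)" using fin S(2) by simp
    then show ?thesis using AB y S by (intro exI[of _ ?V]) auto
  qed
qed

lemma infinite_Hausdorff_disjoint_open:
  assumes H: "Hausdorff_space (euclidean :: 'k::topological_space topology)" and inf: "infinite (UNIV :: 'k set)"
  obtains U :: "nat \<Rightarrow> 'k::topological_space set" where "\<And>n. open (U n)" "\<And>n. U n \<noteq> {}" "\<And>m n. m \<noteq> n \<Longrightarrow> U m \<inter> U n = {}"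
proof -
  \<comment> \<open>The first component is the open set chosen now, the second the infinite open
    room for all later choices.\<close>
  define good where "good p \<longleftrightarrow> open (fst p) \<and> fst p \<noteq> {} \<and> open (snd p) \<and> infinite (snd p) \<and> fst p \<inter> snd p = {}"
    for p :: "'k set \<times> 'k set"
  have step: "\<exists>p. good p \<and> fst p \<subseteq> S \<and> snd p \<subseteq> S" if S: "open S" "infinite S" for S
  proof -
    obtain U where U: "open U" "U \<noteq> {}" "U \<subseteq> S" "infinite (S - closure U)"
      using Hausdorff_split_open[OF H S] by blast
    then have "good (U, S - closure U)"
      using S closure_subset[of U] by (auto simp: good_def intro: open_Diff)
    then show ?thesis using U by (intro exI[of _ "(U, S - closure U)"]) auto
  qed
  have "\<exists>p. \<forall>n. good (p n) \<and> (fst (p (Suc n)) \<subseteq> snd (p n) \<and> snd (p (Suc n)) \<subseteq> snd (p n))"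
  proof (rule dependent_nat_choice)
    show "\<exists>p. good p" using step[of UNIV] inf by auto
    show "\<exists>p'. good p' \<and> (fst p' \<subseteq> snd p \<and> snd p' \<subseteq> snd p)" if "good p" for p n
      using step[of "snd p"] that by (simp add: good_def)
  qed
  then obtain p where p: "\<And>n. good (p n)" "\<And>n. fst (p (Suc n)) \<subseteq> snd (p n)" "\<And>n. snd (p (Suc n)) \<subseteq> snd (p n)"
    by blast
  have mono: "snd (p n) \<subseteq> snd (p m)" if "m \<le> n" for m n
    by (rule lift_Suc_antimono_le[of "\<lambda>n. snd (p n)", OF p(3) that])
  have "fst (p n) \<subseteq> snd (p m)" if "m < n" for m n
    using p(2)[of "n - 1"] mono[of m "n - 1"] that by (cases n) auto
  then have lt: "fst (p m) \<inter> fst (p n) = {}" if "m < n" for m n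
    using p(1)[of m] that unfolding good_def by blast
  show ?thesis
  proof (rule that[of "\<lambda>n. fst (p n)"])
    show "fst (p m) \<inter> fst (p n) = {}" if "m \<noteq> n" for m n
      using lt[of m n] lt[of n m] that by (cases "m < n") auto
  qed (use p(1) in \<open>auto simp: good_def\<close>)
qed

lemma disjoint_bump_functions:
  assumes K: "compact (UNIV :: 'k::topological_space set)" and H: "Hausdorff_space (euclidean :: 'k topology)"
    and cr: "completely_regular_space (euclidean :: 'k topology)" and inf: "infinite (UNIV :: 'k set)"
  shows "\<exists>(u :: nat \<Rightarrow> 'k \<Rightarrow>\<^sub>C real) x. (\<forall>n y. \<bar>u n y\<bar> \<le> 1) \<and> (\<forall>n. u n (x n) = 1) \<and>
    (\<forall>m n y. m \<noteq> n \<longrightarrow> u m y = 0 \<or> u n y = 0)"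
proof -
  obtain U :: "nat \<Rightarrow> 'k set" where U: "\<And>n. open (U n)" "\<And>n. U n \<noteq> {}" "\<And>m n. m \<noteq> n \<Longrightarrow> U m \<inter> U n = {}"
    using infinite_Hausdorff_disjoint_open[OF H inf] by blast
  have "\<forall>n. \<exists>y. y \<in> U n" using U(2) by blast
  then obtain x where x: "\<And>n. x n \<in> U n" by metis
  have "\<exists>f. continuous_on UNIV f \<and> (\<forall>y. f y \<in> {0..1::real}) \<and> f (x n) = 0 \<and> (\<forall>y. y \<notin> U n \<longrightarrow> f y = 1)" for n
  proof -
    have "closedin euclidean (- U n)" "x n \<in> topspace euclidean - (- U n)" using U(1) x by (auto simp: closed_Compl)
    then obtain f :: "'k \<Rightarrow> real" where f: "continuous_map euclidean (top_of_set {0..1}) f" "f (x n) = 0" "f ` (- U n) \<subseteq> {1}"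
      using cr unfolding completely_regular_space_def by blast
    then show ?thesis
      by (intro exI[of _ f]) (auto simp: continuous_map_in_subtopology image_subset_iff Pi_iff)
  qed
  then obtain f where f: "\<And>n. continuous_on UNIV (f n)" "\<And>n y. f n y \<in> {0..1::real}" "\<And>n. f n (x n) = 0"
    "\<And>n y. y \<notin> U n \<Longrightarrow> f n y = 1" by metis
  define u where "u n = Bcontfun (\<lambda>y. 1 - f n y)" for n
  have u: "apply_bcontfun (u n) y = 1 - f n y" for n y
    unfolding u_def by (subst apply_Bcontfun[OF K]) (auto intro!: continuous_intros f)
  show ?thesis
  proof (intro exI[of _ u] exI[of _ x] conjI allI impI)
    show "u m y = 0 \<or> u n y = 0" if "m \<noteq> n" for m n y
      using U(3)[OF that] f(4)[of y m] f(4)[of y n] by (auto simp: u)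
    show "\<bar>u n y\<bar> \<le> 1" for n y using f(2)[of n y] by (simp add: u)
  qed (simp add: u f(3))
qed

text \<open>The numbers \<open>\<bar>\<phi> (u n)\<bar>\<close> are even summable, with sum at most
  \<open>norm \<phi>\<close>.\<close>

lemma disjoint_weakly_null:
  fixes u :: "nat \<Rightarrow> 'k::topological_space \<Rightarrow>\<^sub>C real"
  assumes K: "compact (UNIV :: 'k set)" and u: "\<And>n y. \<bar>u n y\<bar> \<le> 1"
    and disj: "\<And>m n y. m \<noteq> n \<Longrightarrow> u m y = 0 \<or> u n y = 0"
  shows "(\<lambda>n. blinfun_apply (\<phi> :: ('k \<Rightarrow>\<^sub>C real) \<Rightarrow>\<^sub>L real) (u n)) \<longlonglongrightarrow> 0"
proof -
  have L: "bounded_functional (norm \<phi>) (\<lambda>f. blinfun_apply \<phi> (Bcontfun f))"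
    by (rule bounded_functional_blinfun[OF K]) (use norm_blinfun[of \<phi>] in auto)
  have "(\<Sum>i\<le>n. \<bar>blinfun_apply \<phi> (u i)\<bar>) \<le> norm \<phi>" for n
    using sum_abs_functional_le[OF L, of "{..n}" "\<lambda>i. apply_bcontfun (u i)"]
      sum_disjoint_le[of "{..n}" 1 "\<lambda>i. \<bar>u i _\<bar>"] u disj
    by (simp add: apply_bcontfun_inverse)
  then have "summable (\<lambda>n. \<bar>blinfun_apply \<phi> (u n)\<bar>)" by (intro bounded_imp_summable) auto
  then show ?thesis using summable_LIMSEQ_zero tendsto_rabs_zero_iff by blast
qed

lemma not_weakly_respects_compactness_mackey_dual:
  assumes K: "compact (UNIV :: 'k::topological_space set)" and H: "Hausdorff_space (euclidean :: 'k topology)"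
    and cr: "completely_regular_space (euclidean :: 'k topology)" and inf: "infinite (UNIV :: 'k set)"
  shows "\<not> weakly_respects_compactness (mackey_dual :: (('k \<Rightarrow>\<^sub>C real) \<Rightarrow>\<^sub>L real) topology)"
proof
  let ?H = "mackey_dual :: (('k \<Rightarrow>\<^sub>C real) \<Rightarrow>\<^sub>L real) topology"
  assume "weakly_respects_compactness ?H"
  moreover have "compactin (weak_of ?H) (range delta)"
  proof -
    \<comment> \<open>By Mackey--Arens a Mackey continuous functional is evaluation at some
      \<open>f\<close> in \<open>C(K)\<close>, and its composition with \<open>delta\<close> is
      \<open>f\<close> itself.\<close>
    have "continuous_map euclidean (weak_of ?H) delta"
    proof (rule continuous_map_to_weak_of)
      fix g :: "(('k \<Rightarrow>\<^sub>C real) \<Rightarrow>\<^sub>L real) \<Rightarrow> real" assume "linear g" "continuous_map mackey_dual euclideanreal g"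
      then obtain f where "\<And>\<psi>. g \<psi> = blinfun_apply \<psi> f" using mackey_dual_functional by blast
      then show "continuous_map euclidean euclideanreal (\<lambda>x. g (delta x))" by simp
    qed
    then show ?thesis by (rule image_compactin[rotated]) (simp add: K)
  qed
  ultimately have cpt: "compactin ?H (range delta)" by (simp add: weakly_respects_compactness_def)
  obtain u :: "nat \<Rightarrow> 'k \<Rightarrow>\<^sub>C real" and x where u: "(\<forall>n y. \<bar>u n y\<bar> \<le> 1) \<and> (\<forall>n. u n (x n) = 1) \<and>
    (\<forall>m n y. m \<noteq> n \<longrightarrow> u m y = 0 \<or> u n y = 0)"
    using disjoint_bump_functions[OF K H cr inf] by (elim exE)
  have u1: "\<bar>u n y\<bar> \<le> 1" and ux: "u n (x n) = 1" and disj: "m \<noteq> n \<Longrightarrow> u m y = 0 \<or> u n y = 0" for m n y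
    using u by simp_all
  have "norm (u n) \<le> 1" for n by (rule norm_bound) (use u1 in simp)
  then have "\<exists>W\<in>mackey_sets. range u \<subseteq> W"
    by (rule weakly_null_hull[OF complete_UNIV_bcontfun]) (rule disjoint_weakly_null[OF K u1 disj])
  then obtain W where W: "W \<in> mackey_sets" "range u \<subseteq> W" by blast
  define V where "V y = {\<psi>. \<exists>d<1/2. \<forall>w\<in>W. \<bar>blinfun_apply \<psi> w - blinfun_apply (delta y) w\<bar> \<le> d}" for y
  have "openin ?H (V y)" for y
    unfolding V_def mackey_dual_def by (rule openin_unif_conv_ball[OF W(1)])
  moreover have "delta y \<in> V y" for y by (auto simp: V_def intro!: exI[of _ 0])
  ultimately obtain \<F> where \<F>: "finite \<F>" "\<F> \<subseteq> range V" "range delta \<subseteq> \<Union>\<F>"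
    using compactinD[OF cpt, of "range V"] by blast
  obtain Y where Y: "finite Y" "\<F> = V ` Y" using finite_subset_image[OF \<F>(1,2)] by blast
  have "\<exists>y\<in>Y. delta (x n) \<in> V y" for n using \<F>(3) Y(2) by blast
  then obtain k where k: "\<And>n. k n \<in> Y" "\<And>n. delta (x n) \<in> V (k n)" by metis
  \<comment> \<open>Finitely many neighbourhoods force two evaluations, at \<open>x m\<close> and
    \<open>x n\<close>, into the same one. They then differ by less than 1 on \<open>W\<close>, yet
    \<open>u m\<close> separates them by exactly 1.\<close>
  have "\<not> inj k" using finite_subset[of "range k" Y] Y(1) k(1) range_inj_infinite by blast
  then obtain m n where mn: "m \<noteq> n" "k m = k n" by (auto simp: inj_def)
  have close: "\<bar>apply_bcontfun w (x i) - apply_bcontfun w (k i)\<bar> < 1/2" if "w \<in> W" for w i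
    using k(2)[of i] that by (auto simp: V_def)
  have "u m \<in> W" using W(2) by blast
  then have "\<bar>u m (x m) - u m (k m)\<bar> < 1/2" "\<bar>u m (x n) - u m (k m)\<bar> < 1/2"
    using close[of "u m" m] close[of "u m" n] mn(2) by simp_all
  moreover have "u m (x n) = 0" using disj[OF mn(1), of "x n"] ux[of n] by simp
  ultimately show False using ux[of m] by linarith
qed

theorem proposition3p5:
  fixes H :: "(('k::topological_space \<Rightarrow>\<^sub>C real) \<Rightarrow>\<^sub>L real) topology"
  assumes "infinite (UNIV :: 'k set)"
    and "compact_space (euclidean :: 'k topology)"
    and "F_space (euclidean :: 'k topology)"
    and "H = mackey_dual"
  shows "(complete_lcs H \<and> Schur_property H) \<and> \<not> weakly_respects_compactness H"
proof -
  have K: "compact (UNIV :: 'k set)" using assms(2) by (simp add: compact_space_def)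
  have "Hausdorff_space (euclidean :: 'k topology)" "completely_regular_space (euclidean :: 'k topology)"
    using assms(3) by (auto simp: F_space_def)
  then show ?thesis
    unfolding assms(4)
    using complete_mackey_dual[OF complete_UNIV_bcontfun] Schur_mackey_dual[OF K assms(3)]
      not_weakly_respects_compactness_mackey_dual[OF K _ _ assms(1)] by blast
qed

end
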